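(* Let $d\ge 2$ and let $f:\mathbb{R}^d\to\mathbb{R}$ be $M$-strongly self-concordant, $\mu$-strongly convex and $L$-smooth, with $\varkappa=L/\mu$. Consider the random quasi-Newton method (described in the context) started from $\boldsymbol{x}_0\in\mathbb{R}^d$ and a (possibly random) matrix $\boldsymbol{G}_0$ which always satisfies $\nabla^2 f(\boldsymbol{x}_0)\preceq \boldsymbol{G}_0\preceq \eta\nabla^2 f(\boldsymbol{x}_0)$ for some constant $\eta\ge 1$, and suppose $$M\lambda_0\le \frac{\ln 2}{4\eta(2d+1)}.$$ Then there are nonnegative random variables $\delta_k$ ($k\ge 0$) with $\nabla^2 f(\boldsymbol{x}_k)\preceq \boldsymbol{G}_k\preceq (1+\delta_k)\nabla^2 f(\boldsymbol{x}_k)$ and $\mathbb{E}\,\delta_k\le 2d\eta\left(1-\frac{1}{d\varkappa}\right)^k$ for all $k\ge 0$, such that for any $\delta\in(0,1)$, with probability at least $1-\delta$, we have for all $k\ge 0$, $$\delta_k\le \frac{4d^3\varkappa^2\eta}{\delta}\left(1-\frac{1}{d\varkappa+1}\right)^k\quad\text{and}\quad \lambda_k\le\left(\frac{4d^3\varkappa^2\eta}{\delta}\right)^k\left(1-\frac{1}{d\varkappa+1}\right)^{k(k-1)/2}\lambda_0 .$$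
   Context: A twice differentiable $f:\mathbb{R}^d\to\mathbb{R}$ is $\mu$-strongly convex and $L$-smooth ($\mu,L>0$) if $\mu \boldsymbol{I}_d\preceq\nabla^2 f(\boldsymbol{x})\preceq L\boldsymbol{I}_d$ for all $\boldsymbol{x}$. For positive definite $\nabla^2 f(\boldsymbol{z})$ write $\|\boldsymbol{h}\|_{\boldsymbol{z}}=\sqrt{\boldsymbol{h}^\top\nabla^2 f(\boldsymbol{z})\boldsymbol{h}}$. $f$ is $M$-strongly self-concordant ($M>0$) if $\nabla^2 f(\boldsymbol{y})-\nabla^2 f(\boldsymbol{x})\preceq M\|\boldsymbol{y}-\boldsymbol{x}\|_{\boldsymbol{z}}\nabla^2 f(\boldsymbol{w})$ for all $\boldsymbol{x},\boldsymbol{y},\boldsymbol{z},\boldsymbol{w}\in\mathbb{R}^d$. Here $\preceq$ is the Loewner order on symmetric matrices. Local gradient norm: $\lambda_f(\boldsymbol{x})=\sqrt{\nabla f(\boldsymbol{x})^\top[\nabla^2 f(\boldsymbol{x})]^{-1}\nabla f(\boldsymbol{x})}$, and $\lambda_k=\lambda_f(\boldsymbol{x}_k)$. Broyden family: for symmetric $\boldsymbol{G}\succeq\boldsymbol{A}\succ 0$, $\boldsymbol{u}\in\mathbb{R}^d$, $\tau\in\mathbb{R}$, set $\mathrm{Broyd}_\tau(\boldsymbol{G},\boldsymbol{A},\boldsymbol{u})=\boldsymbol{G}$ if $\boldsymbol{G}\boldsymbol{u}=\boldsymbol{A}\boldsymbol{u}$, and otherwise $$\mathrm{Broyd}_\t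au(\boldsymbol{G},\boldsymbol{A},\boldsymbol{u})=\tau\Big[\boldsymbol{G}-\tfrac{\boldsymbol{A}\boldsymbol{u}\boldsymbol{u}^\top\boldsymbol{G}+\boldsymbol{G}\boldsymbol{u}\boldsymbol{u}^\top\boldsymbol{A}}{\boldsymbol{u}^\top\boldsymbol{A}\boldsymbol{u}}+\big(\tfrac{\boldsymbol{u}^\top\boldsymbol{G}\boldsymbol{u}}{\boldsymbol{u}^\top\boldsymbol{A}\boldsymbol{u}}+1\big)\tfrac{\boldsymbol{A}\boldsymbol{u}\boldsymbol{u}^\top\boldsymbol{A}}{\boldsymbol{u}^\top\boldsymbol{A}\boldsymbol{u}}\Big]+(1-\tau)\Big[\boldsymbol{G}-\tfrac{(\boldsymbol{G}-\boldsymbol{A})\boldsymbol{u}\boldsymbol{u}^\top(\boldsymbol{G}-\boldsymbol{A})}{\boldsymbol{u}^\top(\boldsymbol{G}-\boldsymbol{A})\boldsymbol{u}}\Big].$$ Random quasi-Newton method: given $\boldsymbol{x}_0$ and symmetric $\boldsymbol{G}_0\succeq\nabla^2 f(\boldsymbol{x}_0)$, for $k\ge 0$: (1) $\boldsymbol{x}_{k+1}=\boldsymbol{x}_k-\boldsymbol{G}_k^{-1}\nabla f(\boldsymbol{x}_k)$; (2) $r_k=\|\boldsymbol{x}_{k+1}-\boldsymbol{x}_k\|_{\boldsymbol{x}_k}$, $\tilde{\boldsymbol{G}}_k=(1+Mr_k)\boldsymbol{G}_k$; (3) choose any $\tau_k\in[0,1]$ (possibly depending on the history and on $\boldsymbol{u}_k$,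 but not on later directions) and draw $\boldsymbol{u}_k\sim\mathcal{D}$ independently of the past; (4) $\boldsymbol{G}_{k+1}=\mathrm{Broyd}_{\tau_k}(\tilde{\boldsymbol{G}}_k,\nabla^2 f(\boldsymbol{x}_{k+1}),\boldsymbol{u}_k)$. Here $\mathcal{D}$ is a fixed distribution on $\mathbb{R}^d$ (almost surely nonzero) with $\mathbb{E}_{\boldsymbol{u}\sim\mathcal{D}}\frac{\boldsymbol{u}\boldsymbol{u}^\top}{\boldsymbol{u}^\top\boldsymbol{u}}=\frac1d\boldsymbol{I}_d$. Probability and expectation are over the random directions (and $\boldsymbol{G}_0$, if random). *)

theory Defs
  imports "HOL-Probability.Probability"
begin

section \<open>Loewner order and rank-one matrices\<close>

definition loewner_le :: "real^'n^'n \<Rightarrow> real^'n^'n \<Rightarrow> bool"  (infix "\<preceq>" 50) where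
  "A \<preceq> B \<longleftrightarrow> transpose A = A \<and> transpose B = B \<and> (\<forall>v. v \<bullet> (A *v v) \<le> v \<bullet> (B *v v))"

definition outer :: "real^'n \<Rightarrow> real^'n \<Rightarrow> real^'n^'n" where
  "outer u v = (\<chi> i j. u $ i * v $ j)"


section \<open>Gradient, Hessian and function classes\<close>

text \<open>The library has the gradient only as a relation. Both functions below are meaningful
  under \<open>twice_differentiable f\<close>.\<close>

definition gradient :: "(real^'n \<Rightarrow> real) \<Rightarrow> real^'n \<Rightarrow> real^'n" where
  "gradient f x = (THE g. GDERIV f x :> g)"

definition hessian :: "(real^'n \<Rightarrow> real) \<Rightarrow> real^'n \<Rightarrow> real^'n^'n" where
  "hessian f x = jacobian (gradient f) (at x)"

definition twice_differentiable :: "(real^'n \<Rightarrow> real) \<Rightarrow> bool" where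
  "twice_differentiable f \<longleftrightarrow>
     (\<forall>x. f differentiable (at x)) \<and> (\<forall>x. gradient f differentiable (at x))"

definition strongly_convex :: "real \<Rightarrow> (real^'n \<Rightarrow> real) \<Rightarrow> bool" where
  "strongly_convex \<mu> f \<longleftrightarrow> (\<forall>x. \<mu> *\<^sub>R mat 1 \<preceq> hessian f x)"

definition L_smooth :: "real \<Rightarrow> (real^'n \<Rightarrow> real) \<Rightarrow> bool" where
  "L_smooth L f \<longleftrightarrow> (\<forall>x. hessian f x \<preceq> L *\<^sub>R mat 1)"

definition local_norm :: "(real^'n \<Rightarrow> real) \<Rightarrow> real^'n \<Rightarrow> real^'n \<Rightarrow> real" where
  "local_norm f z h = sqrt (h \<bullet> (hessian f z *v h))"

definition strongly_self_concordant :: "real \<Rightarrow> (real^'n \<Rightarrow> real) \<Rightarrow> bool" where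
  "strongly_self_concordant M f \<longleftrightarrow>
     (\<forall>x y z w. hessian f y - hessian f x \<preceq> (M * local_norm f z (y - x)) *\<^sub>R hessian f w)"

definition local_grad_norm :: "(real^'n \<Rightarrow> real) \<Rightarrow> real^'n \<Rightarrow> real" where
  "local_grad_norm f x = sqrt (gradient f x \<bullet> (matrix_inv (hessian f x) *v gradient f x))"


section \<open>Broyden family and the quasi-Newton iteration\<close>

definition Broyd :: "real \<Rightarrow> real^'n^'n \<Rightarrow> real^'n^'n \<Rightarrow> real^'n \<Rightarrow> real^'n^'n" where
  "Broyd \<tau> G A u =
     (if G *v u = A *v u then G
      else
        \<tau> *\<^sub>R
          (G - (1 / (u \<bullet> (A *v u))) *\<^sub>R (A ** outer u u ** G + G ** outer u u ** A)
             + ((u \<bullet> (G *v u)) / (u \<bullet> (A *v u)) + 1) *\<^sub>R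
                 ((1 / (u \<bullet> (A *v u))) *\<^sub>R (A ** outer u u ** A)))
      + (1 - \<tau>) *\<^sub>R
          (G - (1 / (u \<bullet> ((G - A) *v u))) *\<^sub>R ((G - A) ** outer u u ** (G - A))))"

text \<open>One trajectory of the method; the initial matrix is \<open>G 0\<close>.\<close>

definition quasi_newton_run ::
  "(real^'n \<Rightarrow> real) \<Rightarrow> real \<Rightarrow> real^'n \<Rightarrow> (nat \<Rightarrow> real) \<Rightarrow> (nat \<Rightarrow> real^'n) \<Rightarrow>
   (nat \<Rightarrow> real^'n) \<Rightarrow> (nat \<Rightarrow> real^'n^'n) \<Rightarrow> bool" where
  "quasi_newton_run f M x0 \<tau> u x G \<longleftrightarrow>
     x 0 = x0 \<and>
     (\<forall>k. x (Suc k) = x k - matrix_inv (G k) *v gradient f (x k) \<and>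
          (let r = local_norm f (x k) (x (Suc k) - x k);
               G' = (1 + M * r) *\<^sub>R G k
           in G (Suc k) = Broyd (\<tau> k) G' (hessian f (x (Suc k))) (u k)))"


section \<open>Randomness\<close>

definition isotropic_directions :: "(real^'n) measure \<Rightarrow> bool" where
  "isotropic_directions D \<longleftrightarrow>
     prob_space D \<and> sets D = sets borel \<and> (AE u in D. u \<noteq> 0) \<and>
     (\<integral>u. (1 / (u \<bullet> u)) *\<^sub>R outer u u \<partial>D) = (1 / real CARD('n)) *\<^sub>R mat 1"

text \<open>\<open>F k\<close> is the information available just before \<open>u k\<close> is drawn: it contains the initial
  matrix and all earlier directions and parameters. Letting \<open>\<tau> k\<close> be \<open>F (Suc k)\<close>-measurable
  allows it to depend on the history and on \<open>u k\<close>, but not on later directions. For a method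
  without further randomness, \<open>F k\<close> is generated by \<open>G0\<close> and \<open>u 0, \<dots>, u (k - 1)\<close>.\<close>

definition random_choices ::
  "'w measure \<Rightarrow> (nat \<Rightarrow> 'w measure) \<Rightarrow> (real^'n) measure \<Rightarrow> ('w \<Rightarrow> real^'n^'n) \<Rightarrow>
   (nat \<Rightarrow> 'w \<Rightarrow> real) \<Rightarrow> (nat \<Rightarrow> 'w \<Rightarrow> real^'n) \<Rightarrow> bool" where
  "random_choices P F D G0 \<tau> u \<longleftrightarrow>
     prob_space P \<and> filtration (space P) F \<and> (\<forall>k. subalgebra P (F k)) \<and>
     G0 \<in> borel_measurable (F 0) \<and>
     (\<forall>k. u k \<in> borel_measurable (F (Suc k)) \<and>
          distr P borel (u k) = D \<and>
          prob_space.indep_set P (sets (F k)) (sets (vimage_algebra (space P) (u k) borel)) \<and>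
          \<tau> k \<in> borel_measurable (F (Suc k)) \<and>
          (\<forall>\<omega>\<in>space P. \<tau> k \<omega> \<in> {0..1}))"

end

theory Submission
  imports Defs
begin

text \<open>Write \<open>A\<^sub>k\<close> for the Hessian at \<open>x\<^sub>k\<close>, \<open>\<sigma>\<^sub>k = tr (A\<^sub>k\<^sup>-\<^sup>1 (G\<^sub>k - A\<^sub>k))\<close> and
  \<open>\<delta>\<^sub>k = \<sigma>\<^sub>k + 2 d M \<lambda>\<^sub>k\<close>. Deterministically, \<open>\<lambda>\<^sub>k\<^sub>+\<^sub>1 \<le> (1 - 1 / (2 \<eta>)) \<lambda>\<^sub>k\<close> and
  \<open>\<lambda>\<^sub>k\<^sub>+\<^sub>1 \<le> 2 \<delta>\<^sub>k \<lambda>\<^sub>k\<close>. A Broyden update along a random direction shrinks \<open>\<sigma>\<close> on average by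
  the factor \<open>1 - 1 / (d \<kappa>)\<close>, up to errors of order \<open>M \<lambda>\<^sub>k\<close>; with \<open>B = 4 \<eta> (2 d + 1) M\<close> the
  weights \<open>exp (B \<lambda>\<^sub>k)\<close> absorb these errors, so that the expectation of
  \<open>exp (B \<lambda>\<^sub>k) \<delta>\<^sub>k\<close> decays geometrically, while the weights stay in \<open>[1, 2]\<close>. Markov's inequality
  and a union bound with thresholds decaying like \<open>(1 - 1 / (d \<kappa> + 1))\<^sup>k\<close> give the
  high-probability bound: the ratio of the two rates is \<open>1 - 1 / (d \<kappa>)\<^sup>2\<close>, whence a geometric series
  with sum \<open>(d \<kappa>)\<^sup>2\<close>.\<close>

section \<open>Positive semidefinite matrices\<close>

text \<open>Rescaling by \<open>1 + M * r k\<close> keeps the update above the new Hessian, but it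
  enlarges the whole of \<open>G k\<close>, and these errors could accumulate. They are paid for by
  the decrease of the local gradient norm: since \<open>l k\<close> is at most
  \<open>2 * \<eta>\<close> times \<open>l k - l (Suc k)\<close>, any error factor of the form
  exp(const * M * l k) is bounded by the growth of a potential that telescopes. This is used once
  pathwise, to keep \<open>G k\<close> below \<open>2 * \<eta>\<close> times the Hessian, and once
  in expectation, for the merit; no series of gradient norms is summed. The averaging works because
  \<open>x (Suc k)\<close> is fixed before \<open>u k\<close> is drawn: the weight, the new Hessian
  and the matrix to be updated are all independent of \<open>u k\<close>. The condition number
  enters by two losses, u^T A u <= L u^T u before averaging and \<mu> tr(A^-1 R) <= tr R after it.
  An adaptive choice of \<open>\<tau> k\<close> is harmless because the trace decrease used below
  bounds both ends of the Broyden family, hence every member.\<close>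

definition psd :: "real^'n^'n \<Rightarrow> bool" where
  "psd R \<longleftrightarrow> transpose R = R \<and> (\<forall>v. 0 \<le> v \<bullet> (R *v v))"

definition pos_def :: "real^'n^'n \<Rightarrow> bool" where
  "pos_def A \<longleftrightarrow> transpose A = A \<and> (\<forall>v. v \<noteq> 0 \<longrightarrow> 0 < v \<bullet> (A *v v))"

lemma transpose_add: "transpose (A + B) = transpose A + transpose (B :: real^'n^'m)"
  by (simp add: transpose_def vec_eq_iff)

lemma transpose_diff: "transpose (A - B) = transpose A - transpose (B :: real^'n^'m)"
  by (simp add: transpose_def vec_eq_iff)

lemma scaleR_matrix_vector: "(c *\<^sub>R A) *v v = c *\<^sub>R (A *v (v :: real^'n))"
  by (simp add: vec_eq_iff matrix_vector_mult_def sum_distrib_left mult.assoc)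

lemma matrix_vector_minus_right: "A *v (- v) = - (A *v (v :: real^'n))"
  using matrix_vector_mult_diff_distrib[of A 0 v] by simp

lemmas mv_simps = matrix_vector_right_distrib matrix_vector_mult_add_rdistrib
  matrix_vector_mult_diff_distrib matrix_vector_mult_diff_rdistrib matrix_vector_mult_scaleR
  scaleR_matrix_vector inner_add_left inner_add_right inner_diff_left inner_diff_right

lemma loewner_iff: "A \<preceq> B \<longleftrightarrow> transpose A = A \<and> psd (B - A)"
proof -
  have "transpose (B - A) = B - A \<longleftrightarrow> transpose B = B" if "transpose A = A"
    using that by (simp add: transpose_diff)
  then show ?thesis
    by (auto simp: loewner_le_def psd_def mv_simps)
qed

lemma symmetric_form: "transpose A = A \<Longrightarrow> v \<bullet> (A *v w) = w \<bullet> (A *v (v :: real^'n))"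
  by (metis dot_lmul_matrix inner_commute transpose_matrix_vector)

lemma pos_def_imp_psd: "pos_def A \<Longrightarrow> psd A"
  unfolding pos_def_def psd_def by (metis inner_zero_left less_eq_real_def order_refl)

text \<open>Stated for the homogeneous form in \<open>s\<close> and \<open>t\<close>, so that
  Cauchy-Schwarz and the mixed bound for Hessian differences are both instances.\<close>

lemma discriminant_bound:
  fixes a b c :: real
  assumes q: "\<And>s t. 0 \<le> s\<^sup>2 * a - 2 * (s * t * b) + t\<^sup>2 * c"
  shows "b\<^sup>2 \<le> a * c"
proof -
  have a0: "0 \<le> a" and c0: "0 \<le> c" using q[of 1 0] q[of 0 1] by auto
  show ?thesis
  proof (cases "a = 0")
    case True
    have "b = 0"
    proof (rule ccontr)
      assume b: "b \<noteq> 0"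
      \<comment> \<open>With \<open>a = 0\<close> the form is affine in \<open>s\<close>; at this
        \<open>s\<close> and \<open>t = 1\<close> its value is - c - 2 < 0.\<close>
      have "(c + 1) / b * 1 * b = c + 1" using b by simp
      then show False using q[of "(c + 1) / b" 1] True c0 by simp
    qed
    then show ?thesis using True by simp
  next
    case False
    \<comment> \<open>The value of the form at \<open>s = b\<close>, \<open>t = a\<close>.\<close>
    have "0 \<le> a * (a * c - b\<^sup>2)"
      using q[of b a] by (simp add: power2_eq_square algebra_simps)
    then have "0 \<le> a * c - b\<^sup>2"
      using False a0 by (simp add: zero_le_mult_iff)
    then show ?thesis by simp
  qed
qed

lemma psd_cauchy_schwarz:
  fixes v w :: "real^'n"
  assumes "psd R"
  shows "(v \<bullet> (R *v w))\<^sup>2 \<le> (v \<bullet> (R *v v)) * (w \<bullet> (R *v w))"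
proof (rule discriminant_bound)
  fix s t :: real
  have "w \<bullet> (R *v v) = v \<bullet> (R *v w)"
    using assms symmetric_form unfolding psd_def by blast
  moreover have "0 \<le> (s *\<^sub>R v - t *\<^sub>R w) \<bullet> (R *v (s *\<^sub>R v - t *\<^sub>R w))"
    using assms by (simp only: psd_def)
  ultimately show "0 \<le> s\<^sup>2 * (v \<bullet> (R *v v)) - 2 * (s * t * (v \<bullet> (R *v w))) + t\<^sup>2 * (w \<bullet> (R *v w))"
    by (simp add: mv_simps power2_eq_square algebra_simps)
qed

text \<open>Cauchy-Schwarz between \<open>u\<close> and \<open>R *v u\<close> itself.\<close>

lemma psd_form_zero:
  assumes "psd R" "u \<bullet> (R *v u) = 0"
  shows "R *v u = 0"
proof -
  have "((R *v u) \<bullet> (R *v u))\<^sup>2 \<le> 0"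
    using psd_cauchy_schwarz[OF assms(1), of "R *v u" u] assms(2) by simp
  then show ?thesis by simp
qed

lemma psd_form_pos:
  assumes "psd R" "R *v u \<noteq> 0"
  shows "0 < u \<bullet> (R *v u)"
  using psd_form_zero[OF assms(1)] assms by (metis less_eq_real_def psd_def)

lemma outer_mult_vector: "outer a b *v v = (b \<bullet> v) *\<^sub>R (a :: real^'n)"
  by (simp add: vec_eq_iff outer_def matrix_vector_mult_def inner_vec_def sum_distrib_left mult_ac)

lemma transpose_outer: "transpose (outer a b) = outer b (a :: real^'n)"
  by (simp add: vec_eq_iff outer_def transpose_def mult.commute)

lemma matrix_mult_outer: "A ** outer a b = outer (A *v a) (b :: real^'n)"
  by (simp add: vec_eq_iff outer_def matrix_vector_mult_def matrix_matrix_mult_def sum_distrib_left mult_ac)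

lemma outer_mult_matrix: "outer a b ** A = outer a (transpose A *v (b :: real^'n))"
  by (metis matrix_mult_outer matrix_transpose_mul transpose_outer transpose_transpose)

lemma trace_outer: "trace (outer a b) = a \<bullet> (b :: real^'n)"
  by (simp add: trace_def outer_def inner_vec_def)

lemma trace_mult_outer: "trace (B ** outer a b) = b \<bullet> (B *v (a :: real^'n))"
  by (simp add: matrix_mult_outer trace_outer inner_commute)

lemma trace_scaleR: "trace (c *\<^sub>R A) = c * trace (A :: real^'n^'n)"
  by (simp add: trace_def sum_distrib_left)

text \<open>The difference is a Schur complement; its nonnegativity at \<open>v\<close> is exactly
  Cauchy-Schwarz for \<open>R\<close> at \<open>v\<close> and \<open>u\<close>.\<close>

lemma psd_rank_one_update:
  assumes "psd R" "R *v u \<noteq> 0"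
  shows "psd (R - (1 / (u \<bullet> (R *v u))) *\<^sub>R outer (R *v u) (R *v u))"
  unfolding psd_def
proof (intro conjI allI)
  show "transpose (R - (1 / (u \<bullet> (R *v u))) *\<^sub>R outer (R *v u) (R *v u)) =
      R - (1 / (u \<bullet> (R *v u))) *\<^sub>R outer (R *v u) (R *v u)"
    using assms(1) by (simp add: transpose_diff transpose_scalar transpose_outer psd_def)
  fix v
  have p: "0 < u \<bullet> (R *v u)" by (rule psd_form_pos[OF assms])
  have "(v \<bullet> (R *v u))\<^sup>2 / (u \<bullet> (R *v u)) \<le> v \<bullet> (R *v v)"
    using psd_cauchy_schwarz[OF assms(1), of v u] p by (simp add: divide_le_eq)
  then show "0 \<le> v \<bullet> ((R - (1 / (u \<bullet> (R *v u))) *\<^sub>R outer (R *v u) (R *v u)) *v v)"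
    by (simp add: mv_simps outer_mult_vector power2_eq_square inner_commute)
qed

text \<open>Cholesky elimination: subtracting \<open>R u (R u)\<^sup>T / (u\<^sup>T R u)\<close> for \<open>u\<close> running through the
  standard basis kills one basis vector after the other, so every positive semidefinite matrix
  is a sum of rank-one matrices.\<close>

lemma psd_linear_nonneg:
  fixes R :: "real^'n^'n"
  assumes add: "\<And>A B. \<phi> (A + B) = \<phi> A + \<phi> B" and scale: "\<And>c A. \<phi> (c *\<^sub>R A) = c * \<phi> A"
    and outer: "\<And>b. 0 \<le> \<phi> (outer b b :: real^'n^'n)"
    and R: "psd R"
  shows "0 \<le> (\<phi> R :: real)"
proof -
  \<comment> \<open>\<open>S\<close> collects the indices whose basis vectors may still lie outside
    the kernel; each elimination removes one of them, and the empty set leaves only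
    \<open>R = 0\<close>.\<close>
  have "\<forall>R. psd R \<and> (\<forall>i\<in>-S. R *v axis i 1 = 0) \<longrightarrow> 0 \<le> \<phi> R" if "finite S" for S :: "'n set"
    using that
  proof (induction S)
    case empty
    have "R = 0" if "\<forall>i. R *v axis i 1 = 0" for R :: "real^'n^'n"
      using that by (simp add: matrix_vector_mult_basis column_def vec_eq_iff)
    moreover have "\<phi> 0 = 0" using scale[of 0 0] by simp
    ultimately show ?case by (metis Compl_iff empty_iff order_refl)
  next
    case (insert j S)
    show ?case
    proof (intro allI impI)
      fix R :: "real^'n^'n"
      assume a: "psd R \<and> (\<forall>i\<in>-insert j S. R *v axis i 1 = 0)"
      show "0 \<le> \<phi> R"
      proof (cases "R *v axis j 1 = 0")
        case True
        then show ?thesis using a insert.IH by auto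
      next
        case False
        define u :: "real^'n" where "u = axis j 1"
        define R' where "R' = R - (1 / (u \<bullet> (R *v u))) *\<^sub>R outer (R *v u) (R *v u)"
        have p: "0 < u \<bullet> (R *v u)" using psd_form_pos a False by (auto simp: u_def)
        have "R' *v axis i 1 = 0" if "i \<in> -S" for i
        proof (cases "i = j")
          case True
          then show ?thesis
            using p by (simp add: R'_def u_def[symmetric] mv_simps outer_mult_vector inner_commute)
        next
          case False
          then have "R *v axis i 1 = 0" using a that by auto
          moreover have "(R *v u) \<bullet> axis i 1 = u \<bullet> (R *v axis i 1)"
            using a symmetric_form[of R u "axis i 1"] by (simp add: psd_def inner_commute)
          ultimately show ?thesis by (simp add: R'_def mv_simps outer_mult_vector)
        qed
        then have "0 \<le> \<phi> R'"
          using insert.IH psd_rank_one_update[of R u] a False unfolding R'_def u_def by blast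
        moreover have "\<phi> R = \<phi> R' + (1 / (u \<bullet> (R *v u))) * \<phi> (outer (R *v u) (R *v u))"
          by (simp add: R'_def add[symmetric] scale[symmetric])
        ultimately show ?thesis using p outer by simp
      qed
    qed
  qed
  from this[of UNIV] R show ?thesis by simp
qed

section \<open>Inverses and dual forms of positive definite matrices\<close>

lemma pos_def_inverse:
  assumes "pos_def A"
  shows "A ** matrix_inv A = mat 1" "matrix_inv A ** A = mat 1"
proof -
  have "A *v v = 0 \<longrightarrow> v = 0" for v
    using assms unfolding pos_def_def by (metis inner_zero_right less_irrefl)
  then have "invertible A"
    by (simp add: invertible_left_inverse matrix_left_invertible_ker)
  then show "A ** matrix_inv A = mat 1" "matrix_inv A ** A = mat 1"
    unfolding matrix_inv_def invertible_def by (metis (mono_tags, lifting) someI_ex)+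
qed

lemma pos_def_inverse_vector:
  assumes "pos_def A"
  shows "A *v (matrix_inv A *v v) = v" "matrix_inv A *v (A *v v) = v"
  using pos_def_inverse[OF assms] by (simp_all add: matrix_vector_mul_assoc)

lemma symmetric_matrix_inv:
  assumes "pos_def A"
  shows "transpose (matrix_inv A) = matrix_inv A"
proof -
  have "transpose (matrix_inv A) ** A = mat 1"
    using pos_def_inverse(1)[OF assms] assms
    by (metis matrix_transpose_mul pos_def_def transpose_mat)
  then show ?thesis
    by (metis matrix_mul_assoc matrix_mul_lid matrix_mul_rid pos_def_inverse(1)[OF assms])
qed

lemma inverse_form:
  assumes "pos_def A"
  shows "b \<bullet> (matrix_inv A *v b) = (matrix_inv A *v b) \<bullet> (A *v (matrix_inv A *v b))"
  by (simp add: pos_def_inverse_vector[OF assms] inner_commute)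

lemma pos_def_matrix_inv:
  assumes "pos_def A"
  shows "pos_def (matrix_inv A)"
proof -
  have "0 < v \<bullet> (matrix_inv A *v v)" if "v \<noteq> 0" for v
  proof -
    have "matrix_inv A *v v \<noteq> 0"
      using pos_def_inverse_vector(1)[OF assms, of v] that by auto
    then show ?thesis using assms inverse_form[OF assms] by (simp add: pos_def_def)
  qed
  then show ?thesis using symmetric_matrix_inv[OF assms] by (simp add: pos_def_def)
qed

text \<open>Cauchy-Schwarz for \<open>A\<close> between \<open>matrix_inv A *v b\<close> and
  \<open>v\<close>.\<close>

lemma dual_cauchy_schwarz:
  assumes "pos_def A"
  shows "(b \<bullet> v)\<^sup>2 \<le> (b \<bullet> (matrix_inv A *v b)) * (v \<bullet> (A *v v))"
proof -
  have "(matrix_inv A *v b) \<bullet> (A *v v) = b \<bullet> v"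
    using symmetric_form[of A "matrix_inv A *v b" v] assms
    by (simp add: pos_def_def pos_def_inverse_vector[OF assms] inner_commute)
  then show ?thesis
    using psd_cauchy_schwarz[OF pos_def_imp_psd[OF assms], of "matrix_inv A *v b" v]
    unfolding inverse_form[OF assms, of b] by simp
qed

lemma pos_def_form_nonneg: "pos_def A \<Longrightarrow> 0 \<le> v \<bullet> (A *v v)"
  using pos_def_imp_psd psd_def by blast

text \<open>Converse of \<open>dual_cauchy_schwarz\<close>: testing at v = A^-1 b gives q^2 <= K q
  for q = b^T A^-1 b. The two lemmas describe the inverse form variationally, which replaces
  simultaneous diagonalisation in all comparisons of inverses.\<close>

lemma dual_bound:
  assumes "pos_def A" "\<And>v. (b \<bullet> v)\<^sup>2 \<le> K * (v \<bullet> (A *v v))"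
  shows "b \<bullet> (matrix_inv A *v b) \<le> K"
proof (cases "b \<bullet> (matrix_inv A *v b) = 0")
  case True
  \<comment> \<open>Here only \<open>0 \<le> K\<close> remains to be shown, and any nonzero vector
    proves it.\<close>
  define v :: "real^'a" where "v = axis undefined 1"
  have "0 < v \<bullet> (A *v v)" using assms(1) by (simp add: pos_def_def v_def)
  moreover have "0 \<le> K * (v \<bullet> (A *v v))" using zero_le_power2 assms(2) by (rule order_trans)
  ultimately show ?thesis using True by (simp add: zero_le_mult_iff)
next
  case False
  define q where "q = b \<bullet> (matrix_inv A *v b)"
  have "q\<^sup>2 \<le> K * q"
    using assms(2)[of "matrix_inv A *v b"] inverse_form[OF assms(1), of b]
    by (simp add: q_def inner_commute)
  moreover have "0 < q"
    using False pos_def_form_nonneg[OF pos_def_matrix_inv[OF assms(1)], of b] by (simp add: q_def)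
  ultimately show ?thesis by (simp add: q_def power2_eq_square)
qed

text \<open>The factor \<open>c\<close> allows two uses: plain order reversal with
  \<open>c = 1\<close>, and comparison of Hessians or approximations up to a distortion.\<close>

lemma inverse_form_antimono:
  assumes "pos_def A" "pos_def B" "\<And>v. v \<bullet> (A *v v) \<le> c * (v \<bullet> (B *v v))"
  shows "b \<bullet> (matrix_inv B *v b) \<le> c * (b \<bullet> (matrix_inv A *v b))"
proof (rule dual_bound[OF assms(2)])
  fix v
  have "(b \<bullet> v)\<^sup>2 \<le> (b \<bullet> (matrix_inv A *v b)) * (v \<bullet> (A *v v))"
    by (rule dual_cauchy_schwarz[OF assms(1)])
  also have "\<dots> \<le> (b \<bullet> (matrix_inv A *v b)) * (c * (v \<bullet> (B *v v)))"
    by (rule mult_left_mono[OF assms(3)]) (rule pos_def_form_nonneg[OF pos_def_matrix_inv[OF assms(1)]])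
  finally show "(b \<bullet> v)\<^sup>2 \<le> c * (b \<bullet> (matrix_inv A *v b)) * (v \<bullet> (B *v v))"
    by (simp add: mult_ac)
qed

section \<open>Relative trace and the Broyden family\<close>

text \<open>The trace of A^(-1/2) R A^(-1/2), that is, the sum of the eigenvalues of
  \<open>R\<close> relative to \<open>A\<close>, written without matrix square roots.\<close>

definition rel_trace :: "real^'n^'n \<Rightarrow> real^'n^'n \<Rightarrow> real" where
  "rel_trace A R = trace (matrix_inv A ** R)"

lemma rel_trace_add: "rel_trace A (R + S) = rel_trace A R + rel_trace A S"
  by (simp add: rel_trace_def matrix_add_ldistrib trace_add)

lemma rel_trace_scaleR: "rel_trace A (c *\<^sub>R R) = c * rel_trace A R"
  unfolding rel_trace_def matrix_scalar_ac scalar_matrix_assoc[symmetric] by (rule trace_scaleR)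

lemma rel_trace_diff: "rel_trace A (R - S) = rel_trace A R - rel_trace A S"
  using rel_trace_add[of A R "(-1) *\<^sub>R S"] by (simp only: rel_trace_scaleR) simp

lemma rel_trace_outer: "rel_trace A (outer a b) = b \<bullet> (matrix_inv A *v a)"
  by (simp add: rel_trace_def trace_mult_outer)

lemma rel_trace_self: "pos_def A \<Longrightarrow> rel_trace A (A :: real^'n^'n) = real CARD('n)"
  by (simp add: rel_trace_def pos_def_inverse trace_I)

text \<open>The product A^-1 R need not be symmetric, so nonnegativity is checked on rank-one
  \<open>R\<close>, where the value is b^T A^-1 b.\<close>

lemma rel_trace_nonneg:
  assumes "pos_def A" "psd R"
  shows "0 \<le> rel_trace A R"
  by (rule psd_linear_nonneg[OF _ _ _ assms(2)])
    (simp_all add: rel_trace_add rel_trace_scaleR rel_trace_outer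
      pos_def_form_nonneg pos_def_matrix_inv assms(1))

text \<open>The largest relative eigenvalue is at most their sum; on rank-one \<open>R\<close> this
  is \<open>dual_cauchy_schwarz\<close>. It turns a bound on the trace into a Loewner bound on
  \<open>G k\<close>.\<close>

lemma form_le_rel_trace:
  assumes "pos_def A" "psd R"
  shows "v \<bullet> (R *v v) \<le> rel_trace A R * (v \<bullet> (A *v v))"
proof -
  have "0 \<le> rel_trace A R * (v \<bullet> (A *v v)) - v \<bullet> (R *v v)"
  proof (rule psd_linear_nonneg[OF _ _ _ assms(2)])
    fix b
    show "0 \<le> rel_trace A (outer b b) * (v \<bullet> (A *v v)) - v \<bullet> (outer b b *v v)"
      using dual_cauchy_schwarz[OF assms(1), of b v]
      by (simp add: rel_trace_outer outer_mult_vector power2_eq_square inner_commute)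
  qed (simp_all add: rel_trace_add rel_trace_scaleR mv_simps algebra_simps)
  then show ?thesis by simp
qed

lemma rel_trace_antimono:
  assumes "pos_def A" "pos_def B" "\<And>v. v \<bullet> (A *v v) \<le> c * (v \<bullet> (B *v v))" "psd R"
  shows "rel_trace B R \<le> c * rel_trace A R"
proof -
  have "0 \<le> c * rel_trace A R - rel_trace B R"
    by (rule psd_linear_nonneg[OF _ _ _ assms(4)])
      (simp_all add: rel_trace_add rel_trace_scaleR rel_trace_outer inverse_form_antimono[OF assms(1-3)]
        algebra_simps)
  then show ?thesis by simp
qed

text \<open>Isotropic averaging produces the Euclidean trace, and this lemma returns to the relative
  one.\<close>

lemma rel_trace_le_trace:
  assumes "pos_def A" "0 < \<mu>" "\<And>v. \<mu> * (v \<bullet> v) \<le> v \<bullet> (A *v v)" "psd R"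
  shows "\<mu> * rel_trace A R \<le> trace R"
proof -
  have "\<mu> * (b \<bullet> (matrix_inv A *v b)) \<le> b \<bullet> b" for b
  proof -
    have "b \<bullet> (matrix_inv A *v b) \<le> (b \<bullet> b) / \<mu>"
    proof (rule dual_bound[OF assms(1)])
      fix v
      have "(b \<bullet> v)\<^sup>2 \<le> (b \<bullet> b) * (v \<bullet> v)" by (rule Cauchy_Schwarz_ineq)
      also have "\<dots> \<le> (b \<bullet> b) * ((v \<bullet> (A *v v)) / \<mu>)"
        using assms(3)[of v] assms(2) by (intro mult_left_mono) (simp_all add: pos_le_divide_eq mult.commute)
      finally show "(b \<bullet> v)\<^sup>2 \<le> b \<bullet> b / \<mu> * (v \<bullet> (A *v v))" by simp
    qed
    then show ?thesis using assms(2) by (simp add: pos_le_divide_eq mult.commute)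
  qed
  then have "0 \<le> trace R - \<mu> * rel_trace A R"
    by - (rule psd_linear_nonneg[OF _ _ _ assms(4)],
      simp_all add: rel_trace_add rel_trace_scaleR rel_trace_outer trace_add trace_scaleR trace_outer
        algebra_simps)
  then show ?thesis by simp
qed

section \<open>Bounds for the Broyden update\<close>

lemma Broyd_eq_outer:
  fixes A G :: "real^'n^'n"
  assumes "transpose A = A" "transpose G = G" "G *v u \<noteq> A *v u"
  defines "a \<equiv> u \<bullet> (A *v u)" and "g \<equiv> u \<bullet> (G *v u)"
  shows "Broyd \<tau> G A u = G
    + \<tau> *\<^sub>R (((g / a + 1) / a) *\<^sub>R outer (A *v u) (A *v u)
        - (1 / a) *\<^sub>R (outer (A *v u) (G *v u) + outer (G *v u) (A *v u)))
    - ((1 - \<tau>) / (g - a)) *\<^sub>R outer (G *v u - A *v u) (G *v u - A *v u)"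
proof -
  have 1: "X ** outer u u ** Y = outer (X *v u) (Y *v u)" if "transpose Y = Y" for X Y :: "real^'n^'n"
    using that by (simp only: matrix_mult_outer outer_mult_matrix)
  have 2: "transpose (G - A) = G - A" using assms by (simp add: transpose_diff)
  have 3: "u \<bullet> ((G - A) *v u) = g - a" by (simp add: mv_simps a_def g_def)
  have 4: "\<tau> *\<^sub>R (G - X + Y) + (1 - \<tau>) *\<^sub>R (G - Z) = G + \<tau> *\<^sub>R (Y - X) - (1 - \<tau>) *\<^sub>R Z"
    for X Y Z :: "real^'n^'n"
    by (simp add: algebra_simps)
  have "Broyd \<tau> G A u =
      \<tau> *\<^sub>R (G - (1 / a) *\<^sub>R (outer (A *v u) (G *v u) + outer (G *v u) (A *v u))
        + (g / a + 1) *\<^sub>R ((1 / a) *\<^sub>R outer (A *v u) (A *v u)))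
      + (1 - \<tau>) *\<^sub>R (G - (1 / (g - a)) *\<^sub>R outer (G *v u - A *v u) (G *v u - A *v u))"
    using assms(3)
    unfolding Broyd_def 3 1[OF assms(1)] 1[OF assms(2)] 1[OF 2] a_def[symmetric] g_def[symmetric]
    by (simp only: if_False matrix_vector_mult_diff_rdistrib)
  then show ?thesis unfolding 4 by simp
qed

lemma Broyd_degenerate: "G *v u = A *v u \<Longrightarrow> Broyd \<tau> G A u = G"
  by (simp add: Broyd_def)

context
  fixes A G :: "real^'n^'n" and u :: "real^'n"
  assumes A: "pos_def A" and AG: "A \<preceq> G"
begin

lemma nondegenerate_direction:
  assumes "G *v u \<noteq> A *v u"
  shows "0 < u \<bullet> (A *v u)" "u \<bullet> (A *v u) < u \<bullet> (G *v u)"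
proof -
  have "u \<noteq> 0" using assms by auto
  then show "0 < u \<bullet> (A *v u)" using A by (simp add: pos_def_def)
  have "0 < u \<bullet> ((G - A) *v u)"
    using AG assms psd_form_pos[of "G - A" u] by (simp add: loewner_iff mv_simps)
  then show "u \<bullet> (A *v u) < u \<bullet> (G *v u)" by (simp add: mv_simps)
qed

lemma symmetric_AG: "transpose A = A" "transpose G = G"
  using AG by (auto simp: loewner_le_def)

text \<open>The DFP part is written as \<open>(v - t u)\<^sup>T G (v - t u) + t\<^sup>2 u\<^sup>T A u\<close> with
  \<open>t = v\<^sup>T A u / u\<^sup>T A u\<close>; replacing \<open>G\<close> by \<open>A\<close> turns this into \<open>v\<^sup>T A v\<close>, which
  makes the DFP update monotone in \<open>G\<close>.\<close>

lemma Broyd_form: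
  assumes "G *v u \<noteq> A *v u"
  defines "t v \<equiv> (v \<bullet> (A *v u)) / (u \<bullet> (A *v u))"
  shows "v \<bullet> (Broyd \<tau> G A u *v v) =
    \<tau> * ((v - t v *\<^sub>R u) \<bullet> (G *v (v - t v *\<^sub>R u)) + (t v)\<^sup>2 * (u \<bullet> (A *v u)))
    + (1 - \<tau>) * (v \<bullet> (G *v v) - (v \<bullet> ((G - A) *v u))\<^sup>2 / (u \<bullet> ((G - A) *v u)))"
proof -
  define a g p q where "a = u \<bullet> (A *v u)" "g = u \<bullet> (G *v u)" "p = v \<bullet> (A *v u)" "q = v \<bullet> (G *v u)"
  note d = a_g_p_q_def
  have a0: "a \<noteq> 0" using nondegenerate_direction[OF assms(1)] by (simp add: d)
  have uGv: "u \<bullet> (G *v v) = q" using symmetric_form[OF symmetric_AG(2)] by (simp add: d)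
  have l: "v \<bullet> (Broyd \<tau> G A u *v v) = v \<bullet> (G *v v)
      + \<tau> * ((g / a + 1) / a * (p * p) - 1 / a * (2 * p * q)) - (1 - \<tau>) / (g - a) * (q - p)\<^sup>2"
    unfolding Broyd_eq_outer[OF symmetric_AG assms(1)]
    by (simp add: mv_simps outer_mult_vector power2_eq_square inner_commute[of "A *v u" v]
      inner_commute[of "G *v u" v] d[symmetric] mult.assoc)
  have e: "(v - t v *\<^sub>R u) \<bullet> (G *v (v - t v *\<^sub>R u)) = v \<bullet> (G *v v) - 2 * t v * q + (t v)\<^sup>2 * g"
    using uGv by (simp add: mv_simps d power2_eq_square algebra_simps)
  have t: "t v = p / a" by (simp add: t_def d)
  have f: "(v \<bullet> ((G - A) *v u))\<^sup>2 / (u \<bullet> ((G - A) *v u)) = (q - p)\<^sup>2 / (g - a)"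
    by (simp add: mv_simps d)
  have h: "- 2 * (p / a) * q + (p / a)\<^sup>2 * g + (p / a)\<^sup>2 * a = (g / a + 1) / a * (p * p) - 1 / a * (2 * p * q)"
    using a0 by (simp add: power2_eq_square field_simps)
  show ?thesis
    unfolding l e f unfolding t a_g_p_q_def(1)[symmetric] h[symmetric] by (simp add: algebra_simps)
qed

lemma symmetric_Broyd: "transpose (Broyd \<tau> G A u) = Broyd \<tau> G A u"
proof (cases "G *v u = A *v u")
  case True
  show ?thesis unfolding Broyd_degenerate[OF True] by (rule symmetric_AG)
next
  case False
  show ?thesis
    unfolding Broyd_eq_outer[OF symmetric_AG False]
    by (simp add: transpose_add transpose_diff transpose_scalar transpose_outer symmetric_AG add.commute)
qed

lemma AG_form: "v \<bullet> (A *v v) \<le> v \<bullet> (G *v v)"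
  using AG by (simp add: loewner_le_def)

text \<open>Pythagoras for the \<open>A\<close>-orthogonal projection of \<open>v\<close> onto the
  line through \<open>u\<close>.\<close>

lemma A_form_split:
  assumes "u \<bullet> (A *v u) \<noteq> 0"
  defines "t v \<equiv> (v \<bullet> (A *v u)) / (u \<bullet> (A *v u))"
  shows "(v - t v *\<^sub>R u) \<bullet> (A *v (v - t v *\<^sub>R u)) + (t v)\<^sup>2 * (u \<bullet> (A *v u)) = v \<bullet> (A *v v)"
proof -
  have "t v * (u \<bullet> (A *v u)) = v \<bullet> (A *v u)" using assms by (simp add: t_def)
  moreover have "u \<bullet> (A *v v) = v \<bullet> (A *v u)" by (rule symmetric_form[OF symmetric_AG(1)])
  ultimately show ?thesis by (simp add: mv_simps power2_eq_square algebra_simps)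
qed

text \<open>Both ends of the family stay above \<open>A\<close>: the DFP part by replacing
  \<open>G\<close> by \<open>A\<close> in its split form, the SR1 part by Cauchy-Schwarz for
  \<open>G - A\<close>. The update is a convex combination of the two.\<close>

lemma Broyd_lower:
  assumes "0 \<le> \<tau>" "\<tau> \<le> 1"
  shows "A \<preceq> Broyd \<tau> G A u"
proof (cases "G *v u = A *v u")
  case True
  show ?thesis unfolding Broyd_degenerate[OF True] by (rule AG)
next
  case False
  note pos = nondegenerate_direction[OF False]
  have "v \<bullet> (A *v v) \<le> v \<bullet> (Broyd \<tau> G A u *v v)" for v
  proof -
    define t where "t = (v \<bullet> (A *v u)) / (u \<bullet> (A *v u))"
    have 1: "v \<bullet> (A *v v) \<le> (v - t *\<^sub>R u) \<bullet> (G *v (v - t *\<^sub>R u)) + t\<^sup>2 * (u \<bullet> (A *v u))"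
      using A_form_split[of v] AG_form[of "v - t *\<^sub>R u"] pos(1) by (simp add: t_def)
    have "(v \<bullet> ((G - A) *v u))\<^sup>2 / (u \<bullet> ((G - A) *v u)) \<le> v \<bullet> ((G - A) *v v)"
      using psd_cauchy_schwarz[of "G - A" v u] AG pos
      by (simp add: loewner_iff divide_le_eq mv_simps)
    then have 2: "v \<bullet> (A *v v) \<le> v \<bullet> (G *v v) - (v \<bullet> ((G - A) *v u))\<^sup>2 / (u \<bullet> ((G - A) *v u))"
      by (simp add: mv_simps)
    have "v \<bullet> (A *v v) = \<tau> * (v \<bullet> (A *v v)) + (1 - \<tau>) * (v \<bullet> (A *v v))"
      by (simp add: algebra_simps)
    also have "\<dots> \<le> v \<bullet> (Broyd \<tau> G A u *v v)"
      unfolding Broyd_form[OF False] t_def[symmetric]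
      using 1 2 assms by (intro add_mono mult_left_mono) auto
    finally show ?thesis .
  qed
  then show ?thesis using symmetric_AG symmetric_Broyd by (simp add: loewner_le_def)
qed

text \<open>SR1 only decreases \<open>G\<close>. The DFP form contains a summand t^2 u^T A u that
  does not come from \<open>G\<close>; \<open>1 \<le> c\<close> covers it.\<close>

lemma Broyd_upper:
  assumes "0 \<le> \<tau>" "\<tau> \<le> 1" "1 \<le> c" and c: "\<And>v. v \<bullet> (G *v v) \<le> c * (v \<bullet> (A *v v))"
  shows "v \<bullet> (Broyd \<tau> G A u *v v) \<le> c * (v \<bullet> (A *v v))"
proof (cases "G *v u = A *v u")
  case True
  show ?thesis unfolding Broyd_degenerate[OF True] by (rule c)
next
  case False
  note pos = nondegenerate_direction[OF False]
  define t where "t = (v \<bullet> (A *v u)) / (u \<bullet> (A *v u))"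
  have "t\<^sup>2 * (u \<bullet> (A *v u)) \<le> c * (t\<^sup>2 * (u \<bullet> (A *v u)))"
    using assms(3) pos(1) mult_right_mono[of 1 c "t\<^sup>2 * (u \<bullet> (A *v u))"] by simp
  then have "(v - t *\<^sub>R u) \<bullet> (G *v (v - t *\<^sub>R u)) + t\<^sup>2 * (u \<bullet> (A *v u))
      \<le> c * ((v - t *\<^sub>R u) \<bullet> (A *v (v - t *\<^sub>R u))) + c * (t\<^sup>2 * (u \<bullet> (A *v u)))"
    by (intro add_mono c)
  also have "\<dots> = c * (v \<bullet> (A *v v))"
    using A_form_split[of v, folded t_def] pos(1) by (simp flip: distrib_left)
  finally have 1: "(v - t *\<^sub>R u) \<bullet> (G *v (v - t *\<^sub>R u)) + t\<^sup>2 * (u \<bullet> (A *v u)) \<le> c * (v \<bullet> (A *v v))" .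
  have "0 \<le> (v \<bullet> ((G - A) *v u))\<^sup>2 / (u \<bullet> ((G - A) *v u))"
    using pos by (simp add: mv_simps)
  then have 2: "v \<bullet> (G *v v) - (v \<bullet> ((G - A) *v u))\<^sup>2 / (u \<bullet> ((G - A) *v u)) \<le> c * (v \<bullet> (A *v v))"
    using c[of v] by linarith
  have "v \<bullet> (Broyd \<tau> G A u *v v) \<le> \<tau> * (c * (v \<bullet> (A *v v))) + (1 - \<tau>) * (c * (v \<bullet> (A *v v)))"
    unfolding Broyd_form[OF False] t_def[symmetric]
    using 1 2 assms by (intro add_mono mult_left_mono) auto
  then show ?thesis by (simp add: algebra_simps)
qed

text \<open>For DFP the decrease is exactly (g - a) / a. For SR1 it is e^T A^-1 e / (g - a) with e =
  (G - A) u, which is at least as large by \<open>dual_cauchy_schwarz\<close> at \<open>e\<close>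
  and \<open>u\<close>.\<close>

lemma Broyd_rel_trace:
  assumes "0 \<le> \<tau>" "\<tau> \<le> 1"
  shows "rel_trace A (Broyd \<tau> G A u) \<le> rel_trace A G - (u \<bullet> ((G - A) *v u)) / (u \<bullet> (A *v u))"
proof (cases "G *v u = A *v u")
  case True
  then show ?thesis unfolding Broyd_degenerate[OF True] by (simp add: matrix_vector_mult_diff_rdistrib)
next
  case False
  note pos = nondegenerate_direction[OF False]
  define a g where "a = u \<bullet> (A *v u)" "g = u \<bullet> (G *v u)"
  note d = a_g_def
  have p: "0 < a" "0 < g - a" using pos by (auto simp: d)
  define e where "e = G *v u - A *v u"
  have t1: "rel_trace A (outer (A *v u) (A *v u)) = a"
    by (simp add: rel_trace_outer pos_def_inverse_vector[OF A] d inner_commute)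
  have t2: "rel_trace A (outer (A *v u) (G *v u)) = g"
    by (simp add: rel_trace_outer pos_def_inverse_vector[OF A] d inner_commute)
  have t3: "rel_trace A (outer (G *v u) (A *v u)) = g"
    using symmetric_form[OF symmetric_matrix_inv[OF A], of "A *v u" "G *v u"]
    by (simp add: rel_trace_outer pos_def_inverse_vector[OF A] d inner_commute)
  have "(g - a)\<^sup>2 \<le> rel_trace A (outer e e) * a"
    using dual_cauchy_schwarz[OF A, of e u] by (simp add: rel_trace_outer e_def d mv_simps inner_commute)
  then have "(g - a) * (g - a) / (a * (g - a)) \<le> rel_trace A (outer e e) * a / (a * (g - a))"
    using p by (intro divide_right_mono) (simp_all add: power2_eq_square)
  then have t4: "(g - a) / a \<le> rel_trace A (outer e e) / (g - a)"
    using p by simp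
  have k: "(g / a + 1) / a * a - 1 / a * (g + g) = - ((g - a) / a)"
    using p by (simp add: field_simps)
  have "rel_trace A (Broyd \<tau> G A u) = rel_trace A G + \<tau> * ((g / a + 1) / a * a - 1 / a * (g + g))
      - (1 - \<tau>) / (g - a) * rel_trace A (outer e e)"
    unfolding Broyd_eq_outer[OF symmetric_AG False] d[symmetric]
    by (simp only: rel_trace_add rel_trace_diff rel_trace_scaleR t1 t2 t3 e_def)
  also have "\<dots> = rel_trace A G - \<tau> * ((g - a) / a) - (1 - \<tau>) * (rel_trace A (outer e e) / (g - a))"
    unfolding k by simp
  also have "\<dots> \<le> rel_trace A G - \<tau> * ((g - a) / a) - (1 - \<tau>) * ((g - a) / a)"
    using mult_left_mono[OF t4, of "1 - \<tau>"] assms by simp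
  also have "\<dots> = rel_trace A G - (g - a) / a" by algebra
  finally show ?thesis by (simp add: d mv_simps)
qed

end

section \<open>Strongly self-concordant functions\<close>

text \<open>Polarisation: subtracting the \<open>C\<close>-forms at s v + t w and s v - t w isolates
  the mixed term, while in the sum of the \<open>A\<close>-forms it cancels. Self-concordance
  controls Hessian differences only as quadratic forms, but the gradient estimate needs v^T C
  s.\<close>

lemma bilinear_bound_of_quadratic_bound:
  fixes C A :: "real^'n^'n"
  assumes "transpose C = C" "transpose A = A"
    and bound: "\<And>w. \<bar>w \<bullet> (C *v w)\<bar> \<le> k * (w \<bullet> (A *v w))"
  shows "(v \<bullet> (C *v w))\<^sup>2 \<le> (k * (v \<bullet> (A *v v))) * (k * (w \<bullet> (A *v w)))"
proof (rule discriminant_bound)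
  fix s t :: real
  have c: "w \<bullet> (C *v v) = v \<bullet> (C *v w)" and a: "w \<bullet> (A *v v) = v \<bullet> (A *v w)"
    using assms symmetric_form by blast+
  define p where "p = s *\<^sub>R v - t *\<^sub>R w"
  define q where "q = s *\<^sub>R v + t *\<^sub>R w"
  have "0 \<le> k * (p \<bullet> (A *v p)) + k * (q \<bullet> (A *v q)) + (p \<bullet> (C *v p)) - (q \<bullet> (C *v q))"
    using bound[of p] bound[of q] by linarith
  also have "\<dots> = 2 * (s\<^sup>2 * (k * (v \<bullet> (A *v v))) - 2 * (s * t * (v \<bullet> (C *v w))) + t\<^sup>2 * (k * (w \<bullet> (A *v w))))"
    unfolding p_def q_def by (simp add: mv_simps c a power2_eq_square) (simp add: algebra_simps)
  finally show "0 \<le> s\<^sup>2 * (k * (v \<bullet> (A *v v))) - 2 * (s * t * (v \<bullet> (C *v w))) + t\<^sup>2 * (k * (w \<bullet> (A *v w)))"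
    by simp
qed

locale qn_objective =
  fixes f :: "real^'n \<Rightarrow> real" and M \<mu> L :: real
  assumes M: "0 < M" and \<mu>: "0 < \<mu>"
    and diff: "\<And>x. gradient f differentiable (at x)"
    and ssc: "strongly_self_concordant M f"
    and sc: "strongly_convex \<mu> f"
    and smooth: "L_smooth L f"
begin

abbreviation "g \<equiv> gradient f"
abbreviation "H \<equiv> hessian f"

lemma symmetric_H: "transpose (H x) = H x"
  using sc by (simp add: strongly_convex_def loewner_le_def)

lemma H_lower: "\<mu> * (v \<bullet> v) \<le> v \<bullet> (H x *v v)"
  using sc by (simp add: strongly_convex_def loewner_le_def scaleR_matrix_vector)

lemma H_upper: "v \<bullet> (H x *v v) \<le> L * (v \<bullet> v)"
  using smooth by (simp add: L_smooth_def loewner_le_def scaleR_matrix_vector)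

lemma pos_def_H: "pos_def (H x)"
  unfolding pos_def_def
proof (intro conjI allI impI symmetric_H)
  fix v :: "real^'n" assume "v \<noteq> 0"
  then have "0 < \<mu> * (v \<bullet> v)" using \<mu> by simp
  then show "0 < v \<bullet> (H x *v v)" using H_lower by (rule less_le_trans)
qed

lemma \<mu>_le_L: "\<mu> \<le> L"
  using order_trans[OF H_lower H_upper, of "axis undefined 1"] by simp

lemma L_pos: "0 < L" using \<mu> \<mu>_le_L by simp

lemma H_diff:
  "v \<bullet> (H y *v v) - v \<bullet> (H x *v v) \<le> M * local_norm f z (y - x) * (v \<bullet> (H w *v v))"
  using ssc by (simp add: strongly_self_concordant_def loewner_le_def mv_simps)

lemma local_norm_nonneg: "0 \<le> local_norm f z h"
  by (simp add: local_norm_def pos_def_form_nonneg pos_def_H)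

lemma local_norm_sq: "(local_norm f z h)\<^sup>2 = h \<bullet> (H z *v h)"
  by (simp add: local_norm_def pos_def_form_nonneg pos_def_H)

lemma local_norm_scaleR: "local_norm f z (c *\<^sub>R h) = \<bar>c\<bar> * local_norm f z h"
proof -
  have "(c *\<^sub>R h) \<bullet> (H z *v (c *\<^sub>R h)) = c\<^sup>2 * (h \<bullet> (H z *v h))"
    by (simp add: mv_simps power2_eq_square)
  then show ?thesis by (simp add: local_norm_def real_sqrt_mult)
qed

lemma local_norm_minus: "local_norm f z (y - x) = local_norm f z (x - y)"
  using local_norm_scaleR[of z "-1" "x - y"] by simp

lemma local_grad_norm_nonneg: "0 \<le> local_grad_norm f x"
  by (simp add: local_grad_norm_def pos_def_form_nonneg pos_def_matrix_inv pos_def_H)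

lemma local_grad_norm_sq: "(local_grad_norm f x)\<^sup>2 = g x \<bullet> (matrix_inv (H x) *v g x)"
  by (simp add: local_grad_norm_def pos_def_form_nonneg pos_def_matrix_inv pos_def_H)

text \<open>Choosing \<open>w = x\<close> in the self-concordance inequality makes the additive
  bound relative.\<close>

lemma H_ratio: "v \<bullet> (H y *v v) \<le> (1 + M * local_norm f z (y - x)) * (v \<bullet> (H x *v v))"
  using H_diff[of v y x z x] by (simp add: algebra_simps)

text \<open>The scalar mean value theorem along the segment, for one fixed \<open>v\<close>. The
  intermediate point depends on \<open>v\<close>, which is harmless because the Hessian bounds used
  later are uniform along the segment.\<close>

lemma gradient_mean_value:
  "\<exists>t. 0 < t \<and> t < 1 \<and> v \<bullet> (g (x + s) - g x) = v \<bullet> (H (x + t *\<^sub>R s) *v s)"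
proof -
  have D: "((\<lambda>t. v \<bullet> g (x + t *\<^sub>R s)) has_real_derivative v \<bullet> (H (x + t *\<^sub>R s) *v s)) (at t)" for t
  proof -
    have "(g has_derivative (\<lambda>h. H (x + t *\<^sub>R s) *v h)) (at (x + t *\<^sub>R s))"
      using diff[of "x + t *\<^sub>R s"] unfolding hessian_def by (simp add: jacobian_works)
    moreover have "((\<lambda>t. x + t *\<^sub>R s) has_derivative (\<lambda>h. h *\<^sub>R s)) (at t)"
      by (auto intro!: derivative_eq_intros)
    ultimately have "((\<lambda>t. g (x + t *\<^sub>R s)) has_derivative (\<lambda>h. H (x + t *\<^sub>R s) *v (h *\<^sub>R s))) (at t)"
      using diff_chain_at[of "\<lambda>t. x + t *\<^sub>R s" "\<lambda>h. h *\<^sub>R s" t g] by (simp add: o_def)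
    then have "((\<lambda>t. v \<bullet> g (x + t *\<^sub>R s)) has_derivative (\<lambda>h. v \<bullet> (H (x + t *\<^sub>R s) *v (h *\<^sub>R s)))) (at t)"
      by (rule has_derivative_inner_right)
    then show ?thesis
      by (simp add: has_field_derivative_def matrix_vector_mult_scaleR mult.commute[of _ "v \<bullet> _"])
  qed
  obtain t where "0 < t" "t < 1"
    "v \<bullet> g (x + 1 *\<^sub>R s) - v \<bullet> g (x + 0 *\<^sub>R s) = (1 - 0) * (v \<bullet> (H (x + t *\<^sub>R s) *v s))"
    using MVT2[OF zero_less_one D] by auto
  then show ?thesis by (auto simp: inner_diff_right)
qed

end

text \<open>Here \<open>g\<close> plays the gradient, \<open>A\<close> the Hessian and \<open>G\<close> its approximation: the new
  gradient of the quadratic model is \<open>A D g\<close> with \<open>D = A\<^sup>-\<^sup>1 - G\<^sup>-\<^sup>1\<close>, and \<open>0 \<preceq> D \<preceq> (1 - 1 / c) A\<^sup>-\<^sup>1\<close>.\<close>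

lemma quadratic_model_contraction:
  fixes A G :: "real^'n^'n"
  assumes A: "pos_def A" and G: "pos_def G" and c: "1 \<le> c"
    and AG: "\<And>v. v \<bullet> (A *v v) \<le> v \<bullet> (G *v v)"
    and GA: "\<And>v. v \<bullet> (G *v v) \<le> c * (v \<bullet> (A *v v))"
  shows "\<bar>v \<bullet> (g - A *v (matrix_inv G *v g))\<bar>
    \<le> (1 - 1 / c) * sqrt (g \<bullet> (matrix_inv A *v g)) * sqrt (v \<bullet> (A *v v))"
proof -
  define D where "D = matrix_inv A - matrix_inv G"
  have up: "w \<bullet> (D *v w) \<le> (1 - 1 / c) * (w \<bullet> (matrix_inv A *v w))" for w
    using inverse_form_antimono[OF G A GA, of w] c
    by (simp add: D_def mv_simps field_simps)
  have D: "psd D"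
    using inverse_form_antimono[OF A G, of 1] AG symmetric_matrix_inv[OF A] symmetric_matrix_inv[OF G]
    by (simp add: psd_def D_def mv_simps transpose_diff)
  have c1: "0 \<le> 1 - 1 / c" using c by simp
  have eq: "v \<bullet> (g - A *v (matrix_inv G *v g)) = (A *v v) \<bullet> (D *v g)"
  proof -
    have "g - A *v (matrix_inv G *v g) = A *v (D *v g)"
      by (simp add: D_def mv_simps pos_def_inverse_vector[OF A])
    then show ?thesis using symmetric_form[of A v "D *v g"] A by (simp add: pos_def_def inner_commute)
  qed
  have vA: "(A *v v) \<bullet> (matrix_inv A *v (A *v v)) = v \<bullet> (A *v v)"
    by (simp add: pos_def_inverse_vector[OF A] inner_commute)
  have "((A *v v) \<bullet> (D *v g))\<^sup>2 \<le> ((A *v v) \<bullet> (D *v (A *v v))) * (g \<bullet> (D *v g))"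
    by (rule psd_cauchy_schwarz[OF D])
  also have "\<dots> \<le> ((1 - 1 / c) * (v \<bullet> (A *v v))) * ((1 - 1 / c) * (g \<bullet> (matrix_inv A *v g)))"
    using up[of "A *v v"] up[of g] D c1 unfolding vA
    by (intro mult_mono) (auto simp: psd_def pos_def_form_nonneg[OF A])
  also have "\<dots> = ((1 - 1 / c) * sqrt (g \<bullet> (matrix_inv A *v g)) * sqrt (v \<bullet> (A *v v)))\<^sup>2"
    using pos_def_form_nonneg[OF A, of v] pos_def_form_nonneg[OF pos_def_matrix_inv[OF A], of g]
    by (simp add: power_mult_distrib) (simp add: power2_eq_square)
  finally have "\<bar>(A *v v) \<bullet> (D *v g)\<bar> \<le> \<bar>(1 - 1 / c) * sqrt (g \<bullet> (matrix_inv A *v g)) * sqrt (v \<bullet> (A *v v))\<bar>"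
    by (simp only: abs_le_square_iff)
  then show ?thesis
    unfolding eq using c1 pos_def_form_nonneg[OF A, of v] pos_def_form_nonneg[OF pos_def_matrix_inv[OF A], of g]
    by (simp add: abs_mult)
qed

lemma pos_def_above:
  assumes "pos_def A" "A \<preceq> G"
  shows "pos_def G"
  using assms unfolding pos_def_def loewner_le_def by (meson less_le_trans)

section \<open>One step of the iteration from a matrix above the Hessian\<close>

context qn_objective
begin

context
  fixes x s :: "real^'n" and G :: "real^'n^'n" and c r l :: real
  assumes AG: "H x \<preceq> G" and c: "1 \<le> c"
    and GA: "\<And>v. v \<bullet> (G *v v) \<le> c * (v \<bullet> (H x *v v))"
    and s: "s = - (matrix_inv G *v g x)"
    and r: "r = local_norm f x s" and l: "l = local_grad_norm f x"
begin

lemma step_length_bounds: "0 \<le> r" "r \<le> l"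
proof -
  show r0: "0 \<le> r" by (simp add: r local_norm_nonneg)
  have G: "pos_def G" using pos_def_above[OF pos_def_H AG] .
  have AG': "v \<bullet> (H x *v v) \<le> v \<bullet> (G *v v)" for v using AG by (simp add: loewner_le_def)
  have "r\<^sup>2 = s \<bullet> (H x *v s)" by (simp add: r local_norm_sq)
  also have "\<dots> \<le> s \<bullet> (G *v s)" by (rule AG')
  also have "\<dots> = g x \<bullet> (matrix_inv G *v g x)"
    using inverse_form[OF G, of "g x"] by (simp add: s matrix_vector_minus_right)
  also have "\<dots> \<le> l\<^sup>2"
    using inverse_form_antimono[OF pos_def_H G, of x 1 "g x"] AG' by (simp add: l local_grad_norm_sq)
  finally show "r \<le> l" using local_grad_norm_nonneg by (simp add: l power2_le_iff_abs_le r0)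
qed

text \<open>The new gradient is the residual of the quadratic model, which carries the factor 1 -
  1/c, plus C s with C a Hessian difference along the step, which costs M l^2. Passing from the norm
  at \<open>x\<close> to the norm at \<open>x + s\<close> costs sqrt(1 + M r) <= 1 + M l /
  2.\<close>

lemma step_grad_norm: "local_grad_norm f (x + s) \<le> (1 + M * l / 2) * ((1 - 1 / c + M * l) * l)"
proof -
  have G: "pos_def G" using pos_def_above[OF pos_def_H AG] .
  have l0: "0 \<le> l" by (simp add: l local_grad_norm_nonneg)
  have r0: "0 \<le> r" and rl: "r \<le> l" by (rule step_length_bounds)+
  have c1: "0 \<le> 1 - 1 / c" using c by simp
  define K where "K = (1 - 1 / c + M * l) * l"
  have K0: "0 \<le> K" using c1 M l0 by (simp add: K_def)
  have bound: "\<bar>v \<bullet> g (x + s)\<bar> \<le> K * sqrt (v \<bullet> (H x *v v))" for v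
  proof -
    define n where "n = sqrt (v \<bullet> (H x *v v))"
    have n0: "0 \<le> n" by (simp add: n_def pos_def_form_nonneg pos_def_H)
    obtain t where t: "0 < t" "t < 1" "v \<bullet> (g (x + s) - g x) = v \<bullet> (H (x + t *\<^sub>R s) *v s)"
      using gradient_mean_value by blast
    define C where "C = H (x + t *\<^sub>R s) - H x"
    have "\<bar>w \<bullet> (C *v w)\<bar> \<le> (M * r) * (w \<bullet> (H x *v w))" for w
    proof -
      have "local_norm f x (t *\<^sub>R s) \<le> r" "local_norm f x (- (t *\<^sub>R s)) \<le> r"
        using t local_norm_nonneg[of x s] local_norm_minus[of x 0 "t *\<^sub>R s"]
        by (auto simp: local_norm_scaleR r mult_left_le_one_le)
      then have "M * local_norm f x (t *\<^sub>R s) * (w \<bullet> (H x *v w)) \<le> M * r * (w \<bullet> (H x *v w))"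
        "M * local_norm f x (- (t *\<^sub>R s)) * (w \<bullet> (H x *v w)) \<le> M * r * (w \<bullet> (H x *v w))"
        using M by (auto intro!: mult_right_mono simp: pos_def_form_nonneg pos_def_H)
      then show ?thesis
        using H_diff[of w "x + t *\<^sub>R s" x x x] H_diff[of w x "x + t *\<^sub>R s" x x]
        by (simp add: C_def mv_simps abs_le_iff)
    qed
    then have "(v \<bullet> (C *v s))\<^sup>2 \<le> (M * r * (v \<bullet> (H x *v v))) * (M * r * (s \<bullet> (H x *v s)))"
      by (intro bilinear_bound_of_quadratic_bound) (simp_all add: C_def transpose_diff symmetric_H)
    also have "\<dots> = (M * r * r * n)\<^sup>2"
      unfolding n_def local_norm_sq[symmetric] r
      by (simp add: power_mult_distrib pos_def_form_nonneg pos_def_H local_norm_sq)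
        (simp add: local_norm_def pos_def_form_nonneg pos_def_H power2_eq_square)
    finally have "\<bar>v \<bullet> (C *v s)\<bar> \<le> M * r * r * n"
      using r0 n0 M by (simp add: power2_le_iff_abs_le)
    also have "\<dots> \<le> M * l * l * n"
      using r0 rl n0 M by (intro mult_right_mono mult_mono) auto
    finally have 1: "\<bar>v \<bullet> (C *v s)\<bar> \<le> M * l * l * n" .
    have 2: "\<bar>v \<bullet> (g x + H x *v s)\<bar> \<le> (1 - 1 / c) * l * n"
    proof -
      have "H x *v s = - (H x *v (matrix_inv G *v g x))"
        unfolding s by (rule matrix_vector_minus_right)
      then show ?thesis
        using quadratic_model_contraction[OF pos_def_H G c _ GA, of v "g x"] AG
        by (simp add: loewner_le_def l local_grad_norm_def n_def)
    qed
    have "v \<bullet> g (x + s) = v \<bullet> (g x + H x *v s) + v \<bullet> (C *v s)"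
      using t(3) by (simp add: C_def mv_simps)
    then have "\<bar>v \<bullet> g (x + s)\<bar> \<le> (1 - 1 / c) * l * n + M * l * l * n"
      using 1 2 by linarith
    then show ?thesis by (simp add: K_def n_def algebra_simps)
  qed
  have "(local_grad_norm f (x + s))\<^sup>2 \<le> K\<^sup>2 * (1 + M * r)"
    unfolding local_grad_norm_sq
  proof (rule dual_bound[OF pos_def_H])
    fix v
    have "(g (x + s) \<bullet> v)\<^sup>2 \<le> (K * sqrt (v \<bullet> (H x *v v)))\<^sup>2"
      using bound[of v] by (subst inner_commute) (metis abs_ge_zero power2_abs power_mono)
    also have "\<dots> = K\<^sup>2 * (v \<bullet> (H x *v v))"
      by (simp add: power_mult_distrib pos_def_form_nonneg pos_def_H)
    also have "\<dots> \<le> K\<^sup>2 * ((1 + M * r) * (v \<bullet> (H (x + s) *v v)))"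
      using H_ratio[of v x x "x + s"] local_norm_minus[of x "x + s" x]
      by (intro mult_left_mono zero_le_power2) (simp add: r)
    finally show "(g (x + s) \<bullet> v)\<^sup>2 \<le> K\<^sup>2 * (1 + M * r) * (v \<bullet> (H (x + s) *v v))"
      by (simp add: mult.assoc)
  qed
  also have "\<dots> \<le> K\<^sup>2 * (1 + M * l / 2)\<^sup>2"
  proof (rule mult_left_mono)
    have "1 + M * r \<le> 1 + M * l" using M rl by simp
    also have "\<dots> \<le> (1 + M * l / 2)\<^sup>2" by (simp add: power2_sum)
    finally show "1 + M * r \<le> (1 + M * l / 2)\<^sup>2" .
  qed simp
  also have "\<dots> = ((1 + M * l / 2) * K)\<^sup>2" by (simp only: power_mult_distrib mult.commute)
  finally show ?thesis
    unfolding K_def[symmetric] by (rule power2_le_imp_le) (intro mult_nonneg_nonneg add_nonneg_nonneg K0; use M l0 in simp)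
qed

text \<open>This is why the method rescales \<open>G\<close>: the update requires a matrix above the
  new Hessian.\<close>

lemma step_scaled_lower: "H (x + s) \<preceq> (1 + M * r) *\<^sub>R G"
proof -
  have "v \<bullet> (H (x + s) *v v) \<le> v \<bullet> (((1 + M * r) *\<^sub>R G) *v v)" for v
  proof -
    have "v \<bullet> (H (x + s) *v v) \<le> (1 + M * r) * (v \<bullet> (H x *v v))"
      using H_ratio[of v "x + s" x x] by (simp add: r)
    also have "\<dots> \<le> (1 + M * r) * (v \<bullet> (G *v v))"
      using AG M step_length_bounds by (intro mult_left_mono) (auto simp: loewner_le_def)
    finally show ?thesis by (simp add: scaleR_matrix_vector)
  qed
  then show ?thesis using AG symmetric_H by (simp add: loewner_le_def transpose_scalar)
qed

lemma H_le_step: "v \<bullet> (H x *v v) \<le> (1 + M * r) * (v \<bullet> (H (x + s) *v v))"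
  using H_ratio[of v x x "x + s"] local_norm_minus[of x "x + s" x] by (simp add: r)

text \<open>One factor \<open>1 + M * r\<close> is the rescaling, the other compares the Hessians at
  \<open>x\<close> and \<open>x + s\<close>. The same two factors appear in
  \<open>step_scaled_rel_trace\<close>.\<close>

lemma step_scaled_upper:
  "v \<bullet> (((1 + M * r) *\<^sub>R G) *v v) \<le> (1 + M * r)\<^sup>2 * c * (v \<bullet> (H (x + s) *v v))"
proof -
  have "v \<bullet> (((1 + M * r) *\<^sub>R G) *v v) \<le> (1 + M * r) * (c * (v \<bullet> (H x *v v)))"
    unfolding scaleR_matrix_vector inner_scaleR_right
    using M step_length_bounds(1) by (intro mult_left_mono GA) simp
  also have "\<dots> \<le> (1 + M * r) * (c * ((1 + M * r) * (v \<bullet> (H (x + s) *v v))))"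
    using M c step_length_bounds(1) by (intro mult_left_mono H_le_step) auto
  finally show ?thesis by (simp add: power2_eq_square mult_ac)
qed

lemma step_scaled_rel_trace:
  "rel_trace (H (x + s)) ((1 + M * r) *\<^sub>R G) \<le> (1 + M * r)\<^sup>2 * rel_trace (H x) G"
proof -
  have "rel_trace (H (x + s)) G \<le> (1 + M * r) * rel_trace (H x) G"
    by (rule rel_trace_antimono[OF pos_def_H pos_def_H H_le_step])
      (rule pos_def_imp_psd[OF pos_def_above[OF pos_def_H AG]])
  then have "(1 + M * r) * rel_trace (H (x + s)) G \<le> (1 + M * r) * ((1 + M * r) * rel_trace (H x) G)"
    using M step_length_bounds(1) by (intro mult_left_mono) auto
  then show ?thesis by (simp add: rel_trace_scaleR power2_eq_square)
qed

end

end

section \<open>One trajectory\<close>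

text \<open>Gives the uniform bounds that make the entries of the random residual
  integrable.\<close>

lemma psd_entry_bound:
  fixes R :: "real^'n^'n"
  assumes "psd R" "\<And>v. v \<bullet> (R *v v) \<le> K * (v \<bullet> v)"
  shows "\<bar>R $ i $ j\<bar> \<le> K"
proof -
  have e: "axis k 1 \<bullet> (R *v axis l 1) = R $ k $ l" for k l
    by (simp add: inner_axis' matrix_vector_mult_basis column_def)
  have d: "0 \<le> R $ k $ k" "R $ k $ k \<le> K" for k
    using assms(2)[of "axis k 1"] assms(1) e[of k k] by (auto simp: psd_def dest: spec[of _ "axis k 1"])
  have "(R $ i $ j)\<^sup>2 \<le> (R $ i $ i) * (R $ j $ j)"
    using psd_cauchy_schwarz[OF assms(1), of "axis i 1" "axis j 1"] unfolding e .
  also have "\<dots> \<le> K * K" using d by (intro mult_mono) (auto intro: order_trans)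
  finally have "(R $ i $ j)\<^sup>2 \<le> K\<^sup>2" by (simp add: power2_eq_square)
  moreover have "0 \<le> K" using d by (rule order_trans)
  ultimately show ?thesis by (simp only: power2_le_iff_abs_le)
qed

text \<open>Here \<open>m\<close> stands for \<open>M * l k\<close> and \<open>b\<close> for the
  exponent in \<open>c k\<close>. The number 25/36 bounds ln 2, 5/36 is a fifth of it, and 31/36 = 1
  - 5/36 bounds exp(-b) from below.\<close>

lemma contraction_factor_bound:
  fixes m \<eta> b :: real
  assumes "1 \<le> \<eta>" "0 \<le> m" "20 * \<eta> * m \<le> 25 / 36" "0 \<le> b" "b \<le> 5 / 36"
  shows "(1 + m / 2) * (1 - 1 / (\<eta> * exp b) + m) \<le> 1 - 1 / (2 * \<eta>)"
proof -
  define a where "a = 1 / \<eta>"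
  have a: "0 < a" "a \<le> 1" using assms by (auto simp: a_def)
  have m: "m \<le> 25 / 720 * a" using assms by (simp add: a_def field_simps)
  have "31 / 36 \<le> exp (- b)" using exp_ge_add_one_self[of "- b"] assms by linarith
  then have "31 / 36 * a \<le> exp (- b) * a" using a by (intro mult_right_mono) auto
  then have c: "31 / 36 * a \<le> 1 / (\<eta> * exp b)" by (simp add: a_def exp_minus field_simps)
  then have "(1 + m / 2) * (1 - 1 / (\<eta> * exp b) + m) \<le> (1 + m / 2) * (1 - 31 / 36 * a + m)"
    using assms by (intro mult_left_mono) auto
  also have "\<dots> = (1 - 31 / 36 * a + m) + m / 2 * (1 - 31 / 36 * a + m)" by (simp add: distrib_right)
  also have "\<dots> \<le> (1 - 31 / 36 * a + m) + m / 2 * 1"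
    using m a assms by (intro add_left_mono mult_left_mono) auto
  also have "\<dots> \<le> 1 - a / 2" using m a by linarith
  finally show ?thesis by (simp add: a_def)
qed

context qn_objective
begin

text \<open>A step multiplies the relative trace of \<open>G\<close>, which is the excess plus the
  dimension, so the excess gains an additive error of first order 2 d M l. The second summand is
  chosen to absorb it.\<close>

definition merit :: "real^'n \<Rightarrow> real^'n^'n \<Rightarrow> real" where
  "merit y B = rel_trace (H y) (B - H y) + 2 * real CARD('n) * M * local_grad_norm f y"

text \<open>Expressed through the current point and matrix alone, so that it is visibly determined
  before \<open>u k\<close> is drawn.\<close>

definition scaled_residual :: "real^'n \<Rightarrow> real^'n^'n \<Rightarrow> real^'n^'n" where
  "scaled_residual y B = (let s = - (matrix_inv B *v g y) in
    (1 + M * local_norm f y s) *\<^sub>R B - H (y + s))"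

end

locale qn_run = qn_objective f M \<mu> L
  for f :: "real^'n \<Rightarrow> real" and M \<mu> L :: real +
  fixes \<eta> :: real and x0 :: "real^'n" and \<tau> :: "nat \<Rightarrow> real" and u x :: "nat \<Rightarrow> real^'n"
    and G :: "nat \<Rightarrow> real^'n^'n" and d :: real
  assumes \<eta>: "1 \<le> \<eta>" and d: "d = real CARD('n)" and d_ge_2: "2 \<le> d"
    and \<tau>: "\<And>k. 0 \<le> \<tau> k" "\<And>k. \<tau> k \<le> 1"
    and run: "quasi_newton_run f M x0 \<tau> u x G"
    and init: "H x0 \<preceq> G 0" "G 0 \<preceq> \<eta> *\<^sub>R H x0"
    and close: "M * local_grad_norm f x0 \<le> ln 2 / (4 * \<eta> * (2 * d + 1))"
begin

abbreviation "l k \<equiv> local_grad_norm f (x k)"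
abbreviation "s k \<equiv> - (matrix_inv (G k) *v g (x k))"
abbreviation "r k \<equiv> local_norm f (x k) (s k)"
abbreviation "\<theta> k \<equiv> merit (x k) (G k)"

lemma x_0: "x 0 = x0" using run by (simp add: quasi_newton_run_def)

lemma x_Suc: "x (Suc k) = x k + s k" using run by (simp add: quasi_newton_run_def)

lemma G_Suc: "G (Suc k) = Broyd (\<tau> k) ((1 + M * r k) *\<^sub>R G k) (H (x (Suc k))) (u k)"
proof -
  have "x (Suc k) - x k = s k" by (simp add: x_Suc)
  then show ?thesis using run unfolding quasi_newton_run_def Let_def by metis
qed

lemma scaled_residual_eq: "scaled_residual (x k) (G k) = (1 + M * r k) *\<^sub>R G k - H (x (Suc k))"
  by (simp add: scaled_residual_def x_Suc Let_def)

lemma l_nonneg: "0 \<le> l k" by (rule local_grad_norm_nonneg)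

lemma d_nonneg: "0 \<le> d" using d_ge_2 by simp

lemma merit_eq: "merit y B = rel_trace (H y) (B - H y) + 2 * d * M * local_grad_norm f y"
  by (simp add: merit_def d)

lemma rel_trace_H: "rel_trace (H y) (H y) = d"
  by (simp add: rel_trace_self pos_def_H d)

lemma close_product: "4 * \<eta> * (2 * d + 1) * (M * l 0) \<le> ln 2"
proof -
  have "0 < 4 * \<eta> * (2 * d + 1)" using \<eta> d_ge_2 by (intro mult_pos_pos) auto
  then show ?thesis using close by (simp add: x_0 pos_le_divide_eq mult.commute)
qed

text \<open>\<open>2 \<le> d\<close> gives 2d + 1 >= 5, whence 20 = 4 * 5.\<close>

lemma close_5: "20 * \<eta> * (M * l 0) \<le> 25 / 36"
proof -
  have "20 * \<eta> * (M * l 0) = 4 * \<eta> * 5 * (M * l 0)" by simp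
  also have "\<dots> \<le> 4 * \<eta> * (2 * d + 1) * (M * l 0)"
    using \<eta> d_ge_2 M l_nonneg by (intro mult_right_mono mult_left_mono) auto
  also have "\<dots> \<le> 25 / 36" using close_product ln2_le_25_over_36 by linarith
  finally show ?thesis .
qed

text \<open>The distortion allowed for \<open>G k\<close>. Its growth in one step, exp(4 \<eta> M (l
  k - l (Suc k))), dominates (1 + M r k)^2 as soon as \<open>l\<close> drops by
  \<open>l k / (2 * \<eta>)\<close>.\<close>

definition "c k = \<eta> * exp (4 * \<eta> * M * (l 0 - l k))"

section \<open>Induction step of the deterministic invariant\<close>

context
  fixes k
  assumes lower: "H (x k) \<preceq> G k" and upper: "\<And>v. v \<bullet> (G k *v v) \<le> c k * (v \<bullet> (H (x k) *v v))"
    and l_le: "l k \<le> l 0"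
begin

lemma c_ge_1': "1 \<le> c k"
proof -
  have "1 * 1 \<le> \<eta> * exp (4 * \<eta> * M * (l 0 - l k))"
    using \<eta> M l_le by (intro mult_mono) auto
  then show ?thesis by (simp add: c_def)
qed

lemma l_Suc': "l (Suc k) \<le> (1 - 1 / (2 * \<eta>)) * l k"
proof -
  have m: "20 * \<eta> * (M * l k) \<le> 25 / 36"
  proof -
    have "20 * \<eta> * (M * l k) \<le> 20 * \<eta> * (M * l 0)"
      using \<eta> M l_le by (intro mult_left_mono) auto
    then show ?thesis using close_5 by linarith
  qed
  have "4 * \<eta> * M * (l 0 - l k) \<le> 4 * \<eta> * M * l 0"
    using \<eta> M l_nonneg[of k] by (intro mult_left_mono) auto
  also have "\<dots> \<le> 5 / 36" using close_5 by (simp add: mult_ac)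
  finally have b: "4 * \<eta> * M * (l 0 - l k) \<le> 5 / 36" .
  have "l (Suc k) \<le> (1 + M * l k / 2) * ((1 - 1 / c k + M * l k) * l k)"
    using step_grad_norm[OF lower c_ge_1' upper refl refl refl] by (simp add: x_Suc)
  also have "\<dots> = (1 + M * l k / 2) * (1 - 1 / c k + M * l k) * l k" by (simp only: mult.assoc)
  also have "\<dots> \<le> (1 - 1 / (2 * \<eta>)) * l k"
    unfolding c_def using \<eta> M l_nonneg[of k] l_le m b
    by (intro mult_right_mono contraction_factor_bound) auto
  finally show ?thesis .
qed

lemma l_decrease': "l k / (2 * \<eta>) \<le> l k - l (Suc k)"
  using l_Suc' by (simp add: left_diff_distrib)

lemma Broyd_args': "H (x (Suc k)) \<preceq> (1 + M * r k) *\<^sub>R G k"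
    "v \<bullet> (((1 + M * r k) *\<^sub>R G k) *v v) \<le> c (Suc k) * (v \<bullet> (H (x (Suc k)) *v v))"
proof -
  note ctx = lower c_ge_1' upper refl refl refl
  show "H (x (Suc k)) \<preceq> (1 + M * r k) *\<^sub>R G k"
    using step_scaled_lower[OF ctx] by (simp only: x_Suc)
  have "1 + M * r k \<le> 1 + M * l k" using step_length_bounds(2)[OF ctx] M by simp
  also have "\<dots> \<le> exp (M * l k)" by (rule exp_ge_add_one_self)
  finally have "(1 + M * r k)\<^sup>2 \<le> (exp (M * l k))\<^sup>2"
    using step_length_bounds(1)[OF ctx] M by (intro power_mono) auto
  also have "\<dots> = exp (2 * (M * l k))" by (simp flip: exp_double)
  \<comment> \<open>Rewritten so that the guaranteed decrease of \<open>l\<close> pays for the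
    error.\<close>
  also have "\<dots> = exp (4 * \<eta> * M * (l k / (2 * \<eta>)))" using \<eta> by simp
  also have "\<dots> \<le> exp (4 * \<eta> * M * (l k - l (Suc k)))"
    using l_decrease' M \<eta> by (simp only: exp_le_cancel_iff) (intro mult_left_mono, auto)
  finally have "(1 + M * r k)\<^sup>2 * c k \<le> exp (4 * \<eta> * M * (l k - l (Suc k))) * c k"
    using c_ge_1' by (intro mult_right_mono) auto
  also have "\<dots> = c (Suc k)"
    by (simp add: c_def algebra_simps flip: exp_add)
  finally have q: "(1 + M * r k)\<^sup>2 * c k \<le> c (Suc k)" .
  have "v \<bullet> (((1 + M * r k) *\<^sub>R G k) *v v) \<le> (1 + M * r k)\<^sup>2 * c k * (v \<bullet> (H (x (Suc k)) *v v))"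
    using step_scaled_upper[OF ctx] by (simp only: x_Suc)
  also have "\<dots> \<le> c (Suc k) * (v \<bullet> (H (x (Suc k)) *v v))"
    using q by (intro mult_right_mono) (auto simp: pos_def_form_nonneg pos_def_H)
  finally show "v \<bullet> (((1 + M * r k) *\<^sub>R G k) *v v) \<le> c (Suc k) * (v \<bullet> (H (x (Suc k)) *v v))" .
qed

lemma l_Suc_le': "l (Suc k) \<le> l k"
proof -
  have "0 \<le> l k / (2 * \<eta>)" using \<eta> l_nonneg by simp
  then show ?thesis using l_decrease' by linarith
qed

end

text \<open>The claims must be proved together: the decrease of \<open>l\<close> needs the
  distortion bound, and the next distortion bound needs that decrease.\<close>

lemma invariant:
  "H (x k) \<preceq> G k \<and> (\<forall>v. v \<bullet> (G k *v v) \<le> c k * (v \<bullet> (H (x k) *v v))) \<and> l k \<le> l 0"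
proof (induction k)
  case 0
  show ?case using init by (simp add: x_0 c_def loewner_le_def scaleR_matrix_vector)
next
  case (Suc k)
  then have lower: "H (x k) \<preceq> G k" and upper: "\<And>v. v \<bullet> (G k *v v) \<le> c k * (v \<bullet> (H (x k) *v v))"
    and l_le: "l k \<le> l 0" by auto
  note ctx = lower upper l_le
  have l': "l (Suc k) \<le> l 0" using l_Suc_le'[OF ctx] l_le by simp
  have c': "1 \<le> c (Suc k)"
    using \<eta> M l' mult_mono[of 1 \<eta> 1 "exp (4 * \<eta> * M * (l 0 - l (Suc k)))"] by (simp add: c_def)
  show ?case
    unfolding G_Suc
    using Broyd_lower[OF pos_def_H Broyd_args'(1)[OF ctx] \<tau>]
      Broyd_upper[OF pos_def_H Broyd_args'(1)[OF ctx] \<tau> c' Broyd_args'(2)[OF ctx]] l'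
    by blast
qed

lemma lower: "H (x k) \<preceq> G k" and upper: "v \<bullet> (G k *v v) \<le> c k * (v \<bullet> (H (x k) *v v))"
  and l_le: "l k \<le> l 0"
  using invariant by auto

lemmas c_ge_1 = c_ge_1'[OF lower upper l_le]
  and l_decrease = l_decrease'[OF lower upper l_le]
  and Broyd_args = Broyd_args'[OF lower upper l_le]

lemma c_le: "c k \<le> 2 * \<eta>"
proof -
  have "4 * \<eta> * M * (l 0 - l k) \<le> 4 * \<eta> * M * l 0"
    using \<eta> M l_nonneg[of k] by (intro mult_left_mono) auto
  also have "\<dots> \<le> ln 2"
    using close_5 ln2_ge_two_thirds by (simp add: mult_ac)
  finally have "exp (4 * \<eta> * M * (l 0 - l k)) \<le> exp (ln 2)" by (simp only: exp_le_cancel_iff)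
  then show ?thesis using \<eta> by (simp add: c_def)
qed

lemma M_l_le: "M * l k \<le> 1 / 20"
proof -
  have "20 * (M * l k) \<le> 20 * \<eta> * (M * l 0)"
    using \<eta> M l_le[of k] l_nonneg by (intro mult_mono) auto
  then show ?thesis using close_5 by linarith
qed

lemma psd_residual: "psd (G k - H (x k))"
  using lower by (simp add: loewner_iff)

lemma excess_nonneg: "0 \<le> rel_trace (H (x k)) (G k - H (x k))"
  by (rule rel_trace_nonneg[OF pos_def_H psd_residual])

lemma excess_le_merit: "rel_trace (H (x k)) (G k - H (x k)) \<le> \<theta> k"
  using M l_nonneg[of k] d_nonneg by (simp add: merit_eq)

lemma merit_nonneg: "0 \<le> \<theta> k"
  using excess_nonneg excess_le_merit by (rule order_trans)

lemma G_le_excess: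
  "v \<bullet> (G k *v v) \<le> (1 + rel_trace (H (x k)) (G k - H (x k))) * (v \<bullet> (H (x k) *v v))"
  using form_le_rel_trace[OF pos_def_H psd_residual, of v k] by (simp add: mv_simps algebra_simps)

lemma G_le_merit: "G k \<preceq> (1 + \<theta> k) *\<^sub>R H (x k)"
proof -
  have "v \<bullet> (G k *v v) \<le> (1 + \<theta> k) * (v \<bullet> (H (x k) *v v))" for v
    using G_le_excess[of v k] excess_le_merit[of k]
    by (meson add_left_mono mult_right_mono order_trans pos_def_form_nonneg pos_def_H)
  then show ?thesis
    using lower[of k] by (simp add: loewner_le_def scaleR_matrix_vector transpose_scalar)
qed

lemma excess_bound:
  assumes "\<And>v. v \<bullet> (G k *v v) \<le> b * (v \<bullet> (H (x k) *v v))"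
  shows "rel_trace (H (x k)) (G k - H (x k)) \<le> (b - 1) * d"
proof -
  have "psd (b *\<^sub>R H (x k) - G k)"
    using lower[of k] assms by (simp add: psd_def loewner_le_def mv_simps transpose_diff transpose_scalar)
  then have "0 \<le> rel_trace (H (x k)) (b *\<^sub>R H (x k) - G k)" by (rule rel_trace_nonneg[OF pos_def_H])
  then show ?thesis
    by (simp add: rel_trace_diff rel_trace_scaleR rel_trace_H algebra_simps)
qed

lemma merit_0: "\<theta> 0 \<le> d * \<eta>"
proof -
  have "rel_trace (H (x 0)) (G 0 - H (x 0)) \<le> (\<eta> - 1) * d"
    using init(2) by (intro excess_bound) (simp add: x_0 loewner_le_def scaleR_matrix_vector)
  moreover have "2 * d * M * l 0 \<le> d"
    using mult_left_mono[OF M_l_le[of 0], of "2 * d"] d_nonneg by (simp add: mult.assoc)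
  ultimately show ?thesis by (simp add: merit_eq algebra_simps)
qed

lemma merit_bounded: "\<theta> k \<le> 2 * d * \<eta>"
proof -
  have "rel_trace (H (x k)) (G k - H (x k)) \<le> (c k - 1) * d"
    by (rule excess_bound) (rule upper)
  also have "\<dots> \<le> (2 * \<eta> - 1) * d" using c_le d_nonneg by (intro mult_right_mono) auto
  finally have "rel_trace (H (x k)) (G k - H (x k)) \<le> (2 * \<eta> - 1) * d" .
  moreover have "2 * d * M * l k \<le> d"
    using mult_left_mono[OF M_l_le[of k], of "2 * d"] d_nonneg by (simp add: mult.assoc)
  ultimately show ?thesis by (simp add: merit_eq algebra_simps)
qed

text \<open>\<open>step_grad_norm\<close> with distortion 1 + \<sigma> instead of
  \<open>c k\<close>: 1 - 1/(1 + \<sigma>) <= \<sigma>, and the extra \<open>M * l k\<close> fits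
  into the second part of the merit.\<close>

lemma l_Suc_merit: "l (Suc k) \<le> (1 + M * l k) * \<theta> k * l k"
proof -
  define \<sigma> where "\<sigma> = rel_trace (H (x k)) (G k - H (x k))"
  have \<sigma>: "0 \<le> \<sigma>" "\<sigma> + 4 * (M * l k) \<le> \<theta> k" "0 \<le> M * l k"
    using excess_nonneg d_ge_2 M l_nonneg[of k] mult_right_mono[of 4 "2 * d" "M * l k"]
    by (auto simp: \<sigma>_def merit_eq mult.assoc)
  have "1 - 1 / (1 + \<sigma>) \<le> \<sigma>" using \<sigma> by (simp add: field_simps)
  then have "1 - 1 / (1 + \<sigma>) + M * l k \<le> \<theta> k" using \<sigma> by linarith
  moreover have "1 + M * l k / 2 \<le> 1 + M * l k" using \<sigma> by simp
  moreover have "0 \<le> 1 - 1 / (1 + \<sigma>) + M * l k" using \<sigma> by (simp add: add_nonneg_nonneg)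
  moreover have "l (Suc k) \<le> (1 + M * l k / 2) * ((1 - 1 / (1 + \<sigma>) + M * l k) * l k)"
    using step_grad_norm[OF lower _ G_le_excess refl refl refl, of k] \<sigma> by (simp add: x_Suc \<sigma>_def)
  moreover have "(1 + M * l k / 2) * ((1 - 1 / (1 + \<sigma>) + M * l k) * l k) \<le> (1 + M * l k) * (\<theta> k * l k)"
    using calculation(1-3) \<sigma> l_nonneg[of k] merit_nonneg[of k]
    by (intro mult_mono mult_nonneg_nonneg) auto
  ultimately show ?thesis by (simp add: mult.assoc)
qed

lemma l_Suc_merit_2: "l (Suc k) \<le> 2 * \<theta> k * l k"
proof -
  have "(1 + M * l k) * \<theta> k * l k \<le> 2 * \<theta> k * l k"
    using M_l_le[of k] merit_nonneg l_nonneg by (intro mult_right_mono) auto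
  then show ?thesis using l_Suc_merit by (rule order_trans[rotated])
qed

lemma psd_scaled_residual: "psd (scaled_residual (x k) (G k))"
  using Broyd_args(1) by (simp add: scaled_residual_eq loewner_iff)

lemma scaled_residual_form:
  "v \<bullet> (scaled_residual (x k) (G k) *v v) \<le> 2 * \<eta> * L * (v \<bullet> v)"
proof -
  have "v \<bullet> (scaled_residual (x k) (G k) *v v) \<le> c (Suc k) * (v \<bullet> (H (x (Suc k)) *v v))"
    using Broyd_args(2)[of v k] pos_def_form_nonneg[OF pos_def_H, of v "x (Suc k)"]
    by (simp add: scaled_residual_eq matrix_vector_mult_diff_rdistrib inner_diff_right)
  also have "\<dots> \<le> (2 * \<eta>) * (L * (v \<bullet> v))"
    using c_le H_upper \<eta> by (intro mult_mono) (auto simp: pos_def_form_nonneg pos_def_H)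
  finally show ?thesis by (simp add: mult.assoc)
qed

text \<open>Replacing u^T A u by L u^T u frees the denominator from the current point, leaving a
  quadratic form in the normalised direction, which can be averaged.\<close>

lemma excess_Suc:
  assumes "u k \<noteq> 0"
  shows "rel_trace (H (x (Suc k))) (G (Suc k) - H (x (Suc k)))
    \<le> rel_trace (H (x (Suc k))) (scaled_residual (x k) (G k))
      - (u k \<bullet> (scaled_residual (x k) (G k) *v u k)) / (L * (u k \<bullet> u k))"
proof -
  let ?A = "H (x (Suc k))" and ?R = "scaled_residual (x k) (G k)" and ?u = "u k"
  have "rel_trace ?A (G (Suc k)) \<le> rel_trace ?A ((1 + M * r k) *\<^sub>R G k) - (?u \<bullet> (?R *v ?u)) / (?u \<bullet> (?A *v ?u))"
    unfolding G_Suc scaled_residual_eq by (rule Broyd_rel_trace[OF pos_def_H Broyd_args(1) \<tau>])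
  moreover have "(?u \<bullet> (?R *v ?u)) / (L * (?u \<bullet> ?u)) \<le> (?u \<bullet> (?R *v ?u)) / (?u \<bullet> (?A *v ?u))"
    using psd_scaled_residual[of k] H_upper[of ?u] L_pos pos_def_H[of "x (Suc k)"] assms
    by (intro divide_left_mono mult_pos_pos) (auto simp: psd_def pos_def_def intro: less_le_trans)
  ultimately show ?thesis by (simp add: rel_trace_diff scaled_residual_eq)
qed

text \<open>The factor \<open>exp (4 \<eta> (2 d + 1) M \<lambda>\<^sub>k)\<close> absorbs all error terms of one step, because
  \<open>\<lambda>\<^sub>k - \<lambda>\<^sub>k\<^sub>+\<^sub>1 \<ge> \<lambda>\<^sub>k / (2 \<eta>)\<close>.\<close>

lemma weighted_merit_step:
  fixes \<rho> :: real
  defines "B \<equiv> 4 * \<eta> * (2 * d + 1) * M"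
  assumes \<rho>: "1 / 2 \<le> \<rho>"
  shows "exp (B * l (Suc k)) * (\<rho> * rel_trace (H (x (Suc k))) (scaled_residual (x k) (G k))
      + 2 * d * M * l (Suc k)) \<le> \<rho> * (exp (B * l k) * \<theta> k)"
proof -
  define m where "m = M * l k"
  define \<sigma> where "\<sigma> = rel_trace (H (x k)) (G k - H (x k))"
  note ctx = lower c_ge_1 upper refl refl refl
  have m0: "0 \<le> m" using M l_nonneg by (simp add: m_def)
  have \<sigma>0: "0 \<le> \<sigma>" using excess_nonneg by (simp add: \<sigma>_def)
  have \<theta>: "\<theta> k = \<sigma> + 2 * d * m" by (simp add: merit_eq \<sigma>_def m_def mult.assoc)
  have tr: "rel_trace (H (x k)) (G k) = \<sigma> + d"
    by (simp add: \<sigma>_def rel_trace_diff rel_trace_H)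
  have "rel_trace (H (x (Suc k))) (scaled_residual (x k) (G k)) \<le> (1 + M * r k)\<^sup>2 * (\<sigma> + d) - d"
    using step_scaled_rel_trace[OF ctx, of k]
    by (simp add: scaled_residual_eq rel_trace_diff rel_trace_H tr x_Suc)
  also have "\<dots> \<le> (1 + m)\<^sup>2 * (\<sigma> + d) - d"
    using step_length_bounds[OF ctx, of k] M \<sigma>0 d_nonneg
    by (intro diff_right_mono mult_right_mono power_mono) (auto simp: m_def)
  also have "\<dots> \<le> (1 + m)\<^sup>2 * \<theta> k"
  proof -
    \<comment> \<open>Charges the error d ((1 + m)^2 - 1) to the part 2 d m of the merit.\<close>
    have "1 + 2 * m + m\<^sup>2 - 1 \<le> 2 * m * (1 + m)\<^sup>2"
      using m0 by (simp add: power2_eq_square algebra_simps)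
    then have "d * ((1 + m)\<^sup>2 - 1) \<le> d * (2 * m * (1 + m)\<^sup>2)"
      using d_nonneg by (intro mult_left_mono) (simp_all add: power2_sum)
    then show ?thesis by (simp add: \<theta> algebra_simps)
  qed
  finally have 1: "rel_trace (H (x (Suc k))) (scaled_residual (x k) (G k)) \<le> (1 + m)\<^sup>2 * \<theta> k" .
  have "l (Suc k) \<le> (1 + m)\<^sup>2 * \<theta> k * l k"
  proof -
    have "(1 + m) * \<theta> k * l k \<le> (1 + m)\<^sup>2 * \<theta> k * l k"
      using m0 merit_nonneg l_nonneg by (intro mult_right_mono) (auto simp: power2_eq_square algebra_simps)
    then show ?thesis using l_Suc_merit[of k] unfolding m_def by linarith
  qed
  then have "2 * d * M * l (Suc k) \<le> 2 * d * M * ((1 + m)\<^sup>2 * \<theta> k * l k)"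
    using M d_nonneg by (intro mult_left_mono) auto
  also have "\<dots> = 2 * d * m * ((1 + m)\<^sup>2 * \<theta> k)" by (simp add: m_def mult_ac)
  \<comment> \<open>The summand 2 d M l is not touched by the averaging;
    \<open>1 / 2 \<le> \<rho>\<close> gives it the factor \<open>\<rho>\<close> at the price of
    doubling.\<close>
  also have "\<dots> \<le> \<rho> * (4 * d * m) * ((1 + m)\<^sup>2 * \<theta> k)"
    using \<rho> m0 merit_nonneg[of k] mult_right_mono[OF \<rho>, of "4 * d * m"] d_nonneg
    by (intro mult_right_mono) auto
  finally have 2: "2 * d * M * l (Suc k) \<le> \<rho> * (4 * d * m) * ((1 + m)\<^sup>2 * \<theta> k)" .
  have "\<rho> * rel_trace (H (x (Suc k))) (scaled_residual (x k) (G k)) \<le> \<rho> * ((1 + m)\<^sup>2 * \<theta> k)"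
    using 1 \<rho> by (intro mult_left_mono) auto
  with 2 have "\<rho> * rel_trace (H (x (Suc k))) (scaled_residual (x k) (G k)) + 2 * d * M * l (Suc k)
      \<le> \<rho> * \<theta> k * ((1 + m)\<^sup>2 * (1 + 4 * d * m))"
    by (simp add: algebra_simps)
  also have "\<dots> \<le> \<rho> * \<theta> k * ((exp m)\<^sup>2 * exp (4 * d * m))"
    using \<rho> merit_nonneg[of k] m0 exp_ge_add_one_self[of m] exp_ge_add_one_self[of "4 * d * m"] d_nonneg
    by (intro mult_left_mono mult_mono power_mono) auto
  \<comment> \<open>The total error exponent. A decrease of \<open>l\<close> by
    \<open>l k / (2 * \<eta>)\<close> must cover it, which fixes \<open>B\<close>.\<close>
  also have "(exp m)\<^sup>2 * exp (4 * d * m) = exp (2 * (2 * d + 1) * m)"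
    by (simp add: power2_eq_square algebra_simps flip: exp_add)
  finally have "exp (B * l (Suc k)) * (\<rho> * rel_trace (H (x (Suc k))) (scaled_residual (x k) (G k))
      + 2 * d * M * l (Suc k)) \<le> exp (B * l (Suc k)) * (\<rho> * \<theta> k * exp (2 * (2 * d + 1) * m))"
    by (intro mult_left_mono) auto
  also have "\<dots> = \<rho> * (exp (B * l (Suc k) + 2 * (2 * d + 1) * m) * \<theta> k)"
    by (simp add: exp_add mult_ac)
  also have "\<dots> \<le> \<rho> * (exp (B * l k) * \<theta> k)"
  proof -
    have "B * (l k / (2 * \<eta>)) \<le> B * (l k - l (Suc k))"
      using l_decrease[of k] \<eta> M d_nonneg by (intro mult_left_mono) (auto simp: B_def)
    moreover have "B * (l k / (2 * \<eta>)) = 2 * (2 * d + 1) * m"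
      using \<eta> by (simp add: B_def m_def)
    ultimately have "B * l (Suc k) + 2 * (2 * d + 1) * m \<le> B * l k" by (simp add: right_diff_distrib)
    then show ?thesis using \<rho> merit_nonneg[of k] by (intro mult_left_mono mult_right_mono) auto
  qed
  finally show ?thesis .
qed

text \<open>The closeness assumption says precisely that this exponent is at most ln 2; hence the
  factor 2 in the expectation bound.\<close>

lemma exp_weight_0: "exp (4 * \<eta> * (2 * d + 1) * M * l 0) \<le> 2"
proof -
  have "exp (4 * \<eta> * (2 * d + 1) * M * l 0) \<le> exp (ln 2)"
    using close_product by (simp only: exp_le_cancel_iff mult.assoc)
  then show ?thesis by simp
qed

end

section \<open>Measurability\<close>

lemma borel_measurable_vec_iff:
  fixes f :: "'a \<Rightarrow> 'b::euclidean_space^'n"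
  shows "f \<in> borel_measurable N \<longleftrightarrow> (\<forall>i. (\<lambda>x. f x $ i) \<in> borel_measurable N)"
proof
  assume f: "f \<in> borel_measurable N"
  show "\<forall>i. (\<lambda>x. f x $ i) \<in> borel_measurable N"
  proof
    fix i
    have "continuous_on UNIV (\<lambda>v::'b^'n. v $ i)"
      by (rule linear_continuous_on[OF bounded_linear_vec_nth])
    then have "(\<lambda>v::'b^'n. v $ i) \<in> borel_measurable borel"
      by (rule borel_measurable_continuous_onI)
    with f show "(\<lambda>x. f x $ i) \<in> borel_measurable N"
      by (rule measurable_compose)
  qed
next
  assume f: "\<forall>i. (\<lambda>x. f x $ i) \<in> borel_measurable N"
  show "f \<in> borel_measurable N"
  proof (rule iffD2[OF borel_measurable_euclidean_space], rule ballI)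
    fix b :: "'b^'n" assume "b \<in> Basis"
    then obtain i e where "b = axis i e" unfolding Basis_vec_def by blast
    then show "(\<lambda>x. f x \<bullet> b) \<in> borel_measurable N"
      using f by (simp add: inner_axis borel_measurable_inner)
  qed
qed

lemma borel_measurable_nth [measurable (raw)]:
  fixes f :: "'a \<Rightarrow> 'b::euclidean_space^'n"
  shows "f \<in> borel_measurable N \<Longrightarrow> (\<lambda>x. f x $ i) \<in> borel_measurable N"
  by (simp add: borel_measurable_vec_iff)

lemma borel_measurable_vec_lambda:
  fixes f :: "'n::finite \<Rightarrow> 'a \<Rightarrow> 'b::euclidean_space"
  shows "(\<And>i. f i \<in> borel_measurable N) \<Longrightarrow> (\<lambda>x. \<chi> i. f i x) \<in> borel_measurable N"
  by (simp add: borel_measurable_vec_iff)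

lemma borel_measurable_matrix_vector_mult [measurable (raw)]:
  fixes A :: "'a \<Rightarrow> real^'n^'m"
  assumes [measurable]: "A \<in> borel_measurable N" "v \<in> borel_measurable N"
  shows "(\<lambda>x. A x *v v x) \<in> borel_measurable N"
  unfolding matrix_vector_mult_def by (rule borel_measurable_vec_lambda) measurable

lemma borel_measurable_matrix_matrix_mult [measurable (raw)]:
  fixes A :: "'a \<Rightarrow> real^'n^'m" and B :: "'a \<Rightarrow> real^'k^'n"
  assumes [measurable]: "A \<in> borel_measurable N" "B \<in> borel_measurable N"
  shows "(\<lambda>x. A x ** B x) \<in> borel_measurable N"
  unfolding matrix_matrix_mult_def by (intro borel_measurable_vec_lambda) measurable

lemma borel_measurable_outer [measurable (raw)]:
  assumes [measurable]: "a \<in> borel_measurable N" "b \<in> borel_measurable N"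
  shows "(\<lambda>x. outer (a x) (b x)) \<in> borel_measurable N"
  unfolding outer_def by (intro borel_measurable_vec_lambda) measurable

lemma borel_measurable_trace [measurable (raw)]:
  fixes A :: "'a \<Rightarrow> real^'n^'n"
  assumes [measurable]: "A \<in> borel_measurable N"
  shows "(\<lambda>x. trace (A x)) \<in> borel_measurable N"
  unfolding trace_def by measurable

lemma borel_measurable_det [measurable (raw)]:
  fixes A :: "'a \<Rightarrow> real^'n^'n"
  assumes [measurable]: "A \<in> borel_measurable N"
  shows "(\<lambda>x. det (A x)) \<in> borel_measurable N"
  unfolding det_def by measurable

text \<open>Cramer's rule writes the entries as quotients of determinants; \<open>C k l\<close> is
  \<open>A\<close> with column \<open>k\<close> replaced by a basis vector.\<close>

lemma borel_measurable_matrix_inv: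
  fixes A :: "'a \<Rightarrow> real^'n^'n"
  assumes A [measurable]: "A \<in> borel_measurable N" and pd: "\<And>x. x \<in> space N \<Longrightarrow> pos_def (A x)"
  shows "(\<lambda>x. matrix_inv (A x)) \<in> borel_measurable N"
proof -
  define C where "C k l x = (\<chi> i j. if j = k then axis l 1 $ i else A x $ i $ j)" for k l x
  have C [measurable]: "C k l \<in> borel_measurable N" for k l
    unfolding C_def by (intro borel_measurable_vec_lambda) measurable
  have "matrix_inv (A x) $ k $ l = det (C k l x) / det (A x)" if "x \<in> space N" for x k l
  proof -
    have "invertible (A x)"
      using pos_def_inverse[OF pd[OF that]] unfolding invertible_def by blast
    then have "det (A x) \<noteq> 0" by (simp add: invertible_det_nz)
    then have "matrix_inv (A x) *v axis l 1 = (\<chi> k. det (C k l x) / det (A x))"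
      unfolding C_def using pos_def_inverse_vector(1)[OF pd[OF that]] by (simp flip: cramer)
    moreover have "matrix_inv (A x) $ k $ l = (matrix_inv (A x) *v axis l 1) $ k"
      by (simp add: matrix_vector_mult_basis column_def)
    ultimately show ?thesis by simp
  qed
  then have "(\<lambda>x. matrix_inv (A x) $ k $ l) \<in> borel_measurable N \<longleftrightarrow>
      (\<lambda>x. det (C k l x) / det (A x)) \<in> borel_measurable N" for k l
    by (intro measurable_cong)
  then show ?thesis by (simp add: borel_measurable_vec_iff)
qed

lemma borel_measurable_rel_trace:
  fixes A R :: "'a \<Rightarrow> real^'n^'n"
  assumes [measurable]: "A \<in> borel_measurable N" "R \<in> borel_measurable N"
    and pd: "\<And>x. x \<in> space N \<Longrightarrow> pos_def (A x)"
  shows "(\<lambda>x. rel_trace (A x) (R x)) \<in> borel_measurable N"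
proof -
  note [measurable] = borel_measurable_matrix_inv[OF assms(1) pd]
  show ?thesis unfolding rel_trace_def by measurable
qed

lemma borel_measurable_Broyd [measurable (raw)]:
  fixes A G :: "'a \<Rightarrow> real^'n^'n"
  assumes [measurable]: "\<tau> \<in> borel_measurable N" "G \<in> borel_measurable N" "A \<in> borel_measurable N"
    "u \<in> borel_measurable N"
  shows "(\<lambda>x. Broyd (\<tau> x) (G x) (A x) (u x)) \<in> borel_measurable N"
proof -
  have [measurable]: "Measurable.pred N (\<lambda>x. G x *v u x = A x *v u x)"
    unfolding pred_def by measurable
  show ?thesis unfolding Broyd_def by measurable
qed

context qn_objective
begin

lemma borel_measurable_gradient [measurable]: "g \<in> borel_measurable borel"
  using diff by (intro borel_measurable_continuous_onI continuous_at_imp_continuous_on)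
    (simp add: differentiable_imp_continuous_within)

lemma local_norm_le: "local_norm f z h \<le> sqrt L * norm h"
proof -
  have "local_norm f z h \<le> sqrt (L * (h \<bullet> h))" unfolding local_norm_def by (simp add: H_upper)
  then show ?thesis by (simp add: real_sqrt_mult norm_eq_sqrt_inner)
qed

text \<open>Strong self-concordance anchored at the origin makes the forms Lipschitz; twice
  differentiability alone gives no continuity of the Hessian.\<close>

lemma continuous_on_H_form: "continuous_on UNIV (\<lambda>y. v \<bullet> (H y *v v))"
proof -
  define K where "K = M * sqrt L * (v \<bullet> (H 0 *v v))"
  have le: "v \<bullet> (H y *v v) - v \<bullet> (H x *v v) \<le> K * dist x y" for x y
  proof -
    have "v \<bullet> (H y *v v) - v \<bullet> (H x *v v) \<le> M * local_norm f 0 (y - x) * (v \<bullet> (H 0 *v v))"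
      by (rule H_diff)
    also have "\<dots> \<le> M * (sqrt L * norm (y - x)) * (v \<bullet> (H 0 *v v))"
      using M by (intro mult_right_mono mult_left_mono local_norm_le) (auto simp: pos_def_form_nonneg pos_def_H)
    finally show ?thesis by (simp add: K_def dist_norm norm_minus_commute mult_ac)
  qed
  have "K-lipschitz_on UNIV (\<lambda>y. v \<bullet> (H y *v v))"
  proof (rule lipschitz_onI)
    show "0 \<le> K" using M L_pos by (simp add: K_def pos_def_form_nonneg pos_def_H)
    show "dist (v \<bullet> (H x *v v)) (v \<bullet> (H y *v v)) \<le> K * dist x y" for x y
      using le[of x y] le[of y x] by (simp add: dist_real_def abs_le_iff dist_commute)
  qed
  then show ?thesis by (rule lipschitz_on_continuous_on)
qed

text \<open>Polarisation recovers the entries from the forms.\<close>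

lemma borel_measurable_hessian [measurable]: "H \<in> borel_measurable borel"
proof -
  define q where "q v y = v \<bullet> (H y *v v)" for v y
  have q [measurable]: "q v \<in> borel_measurable borel" for v
    unfolding q_def by (intro borel_measurable_continuous_onI continuous_on_H_form)
  have e: "H y $ i $ j = (q (axis i 1 + axis j 1) y - q (axis i 1 - axis j 1) y) / 4" for y i j
  proof -
    have e: "axis k 1 \<bullet> (H y *v axis l 1) = H y $ k $ l" for k l
      by (simp add: inner_axis' matrix_vector_mult_basis column_def)
    have "H y $ j $ i = H y $ i $ j"
      using symmetric_form[OF symmetric_H, of "axis j 1" y "axis i 1"] unfolding e .
    then show ?thesis by (simp add: q_def mv_simps e)
  qed
  have "(\<lambda>y. H y $ i $ j) \<in> borel_measurable borel" for i j
    unfolding e by measurable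
  then show ?thesis by (simp add: borel_measurable_vec_iff)
qed

lemma borel_measurable_local_grad_norm [measurable]:
  "local_grad_norm f \<in> borel_measurable borel"
proof -
  note [measurable] = borel_measurable_matrix_inv[OF borel_measurable_hessian pos_def_H]
  show ?thesis unfolding local_grad_norm_def[abs_def] by measurable
qed

lemma borel_measurable_merit:
  assumes [measurable]: "x \<in> borel_measurable N" "G \<in> borel_measurable N"
  shows "(\<lambda>\<omega>. merit (x \<omega>) (G \<omega>)) \<in> borel_measurable N"
proof -
  have [measurable]: "(\<lambda>\<omega>. rel_trace (H (x \<omega>)) (G \<omega> - H (x \<omega>))) \<in> borel_measurable N"
    by (rule borel_measurable_rel_trace) (simp_all add: pos_def_H)
  show ?thesis unfolding merit_def by measurable
qed

lemma borel_measurable_newton_step: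
  assumes [measurable]: "x \<in> borel_measurable N" and G [measurable]: "G \<in> borel_measurable N"
    and pd: "\<And>\<omega>. \<omega> \<in> space N \<Longrightarrow> pos_def (G \<omega>)"
  shows "(\<lambda>\<omega>. - (matrix_inv (G \<omega>) *v g (x \<omega>))) \<in> borel_measurable N"
    "(\<lambda>\<omega>. local_norm f (x \<omega>) (- (matrix_inv (G \<omega>) *v g (x \<omega>)))) \<in> borel_measurable N"
    "(\<lambda>\<omega>. scaled_residual (x \<omega>) (G \<omega>)) \<in> borel_measurable N"
proof -
  note [measurable] = borel_measurable_matrix_inv[OF G pd]
  show "(\<lambda>\<omega>. - (matrix_inv (G \<omega>) *v g (x \<omega>))) \<in> borel_measurable N"
    by measurable
  show [measurable]: "(\<lambda>\<omega>. local_norm f (x \<omega>) (- (matrix_inv (G \<omega>) *v g (x \<omega>)))) \<in> borel_measurable N"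
    unfolding local_norm_def by measurable
  show "(\<lambda>\<omega>. scaled_residual (x \<omega>) (G \<omega>)) \<in> borel_measurable N"
    unfolding scaled_residual_def Let_def by measurable
qed

end

section \<open>Expected decay of the merit\<close>

text \<open>The sigma-algebras generated by \<open>X\<close> and by \<open>f\<close> of
  \<open>Y\<close> lie inside the two independent ones; \<open>N\<close> plays the past and
  \<open>Y\<close> the fresh direction.\<close>

lemma (in prob_space) indep_var_of_indep_set:
  assumes indep: "indep_set (sets N) (sets (vimage_algebra (space M) Y T))"
    and N: "space N = space M" and X: "X \<in> measurable N S" and f: "f \<in> measurable T U"
    and Y: "Y \<in> measurable M T"
  shows "indep_var S X U (\<lambda>\<omega>. f (Y \<omega>))"
proof -
  have XM: "X \<in> measurable M S"
    using X indep_setD_ev1[OF indep] N by (auto simp: measurable_def)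
  have YM: "(\<lambda>\<omega>. f (Y \<omega>)) \<in> measurable M U" using measurable_compose[OF Y f] .
  have 1: "sigma_sets (space M) {X -` A \<inter> space M |A. A \<in> sets S} \<subseteq> sets N"
    using measurable_sets[OF X] unfolding N[symmetric] by (intro sets.sigma_sets_subset) auto
  have YV: "Y \<in> measurable (vimage_algebra (space M) Y T) T"
    using Y by (intro measurable_vimage_algebra1) (auto simp: measurable_def)
  have YV': "(\<lambda>\<omega>. f (Y \<omega>)) \<in> measurable (vimage_algebra (space M) Y T) U"
    by (rule measurable_compose[OF YV f])
  have 2: "sigma_sets (space M) {(\<lambda>\<omega>. f (Y \<omega>)) -` A \<inter> space M |A. A \<in> sets U}
      \<subseteq> sets (vimage_algebra (space M) Y T)"
  proof -
    have "{(\<lambda>\<omega>. f (Y \<omega>)) -` A \<inter> space M |A. A \<in> sets U} \<subseteq> sets (vimage_algebra (space M) Y T)"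
      using measurable_sets[OF YV'] by auto
    from sets.sigma_sets_subset[OF this] show ?thesis by simp
  qed
  have "indep_set (sigma_sets (space M) {X -` A \<inter> space M |A. A \<in> sets S})
      (sigma_sets (space M) {(\<lambda>\<omega>. f (Y \<omega>)) -` A \<inter> space M |A. A \<in> sets U})"
    using indep unfolding indep_set_def
    by (rule indep_sets_mono_sets) (use 1 2 in \<open>auto split: bool.split\<close>)
  then show ?thesis using XM YM by (simp add: indep_var_eq)
qed

locale qn_random = qn_objective f M \<mu> L
  for f :: "real^'n \<Rightarrow> real" and M \<mu> L :: real +
  fixes \<eta> :: real and x0 :: "real^'n" and d :: real and P :: "'w measure" and F :: "nat \<Rightarrow> 'w measure"
    and D :: "(real^'n) measure" and \<tau> :: "nat \<Rightarrow> 'w \<Rightarrow> real" and u x :: "nat \<Rightarrow> 'w \<Rightarrow> real^'n"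
    and G :: "nat \<Rightarrow> 'w \<Rightarrow> real^'n^'n"
  assumes directions: "isotropic_directions D" and random: "random_choices P F D (G 0) \<tau> u"
    and run: "\<And>\<omega>. \<omega> \<in> space P \<Longrightarrow>
      qn_run f M \<mu> L \<eta> x0 (\<lambda>k. \<tau> k \<omega>) (\<lambda>k. u k \<omega>) (\<lambda>k. x k \<omega>) (\<lambda>k. G k \<omega>) d"
begin

sublocale prob_space P
  using random by (simp add: random_choices_def)

lemma space_F: "space (F k) = space P" and subalg: "subalgebra P (F k)"
  using random by (auto simp: random_choices_def subalgebra_def)

lemma F_Suc: "h \<in> measurable (F k) N \<Longrightarrow> h \<in> measurable (F (Suc k)) N"
  using random filtration.sets_F_mono[of "space P" F k "Suc k"]
  by (auto simp: random_choices_def measurable_def space_F)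

lemma u_measurable: "u k \<in> borel_measurable (F (Suc k))"
  and \<tau>_measurable: "\<tau> k \<in> borel_measurable (F (Suc k))"
  and distr_u: "distr P borel (u k) = D"
  and indep_u: "indep_set (sets (F k)) (sets (vimage_algebra (space P) (u k) borel))"
  using random by (auto simp: random_choices_def)

lemma u_borel [measurable]: "u k \<in> borel_measurable P"
  using measurable_from_subalg[OF subalg u_measurable] .

lemma pos_def_G: "\<omega> \<in> space P \<Longrightarrow> pos_def (G k \<omega>)"
  using qn_run.lower[OF run] pos_def_above[OF pos_def_H] by blast

lemma adapted: "x k \<in> borel_measurable (F k) \<and> G k \<in> borel_measurable (F k)"
proof (induction k)
  case 0
  have "x 0 \<in> borel_measurable (F 0) \<longleftrightarrow> (\<lambda>\<omega>. x0) \<in> borel_measurable (F 0)"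
    by (rule measurable_cong) (simp add: space_F qn_run.x_0[OF run])
  then show ?case using random by (simp add: random_choices_def)
next
  case (Suc k)
  note x' = F_Suc[OF conjunct1[OF Suc.IH]] and G' = F_Suc[OF conjunct2[OF Suc.IH]]
  have pd: "\<omega> \<in> space (F (Suc k)) \<Longrightarrow> pos_def (G k \<omega>)" for \<omega>
    by (simp add: space_F pos_def_G)
  note [measurable] = x' G' borel_measurable_newton_step[OF x' G' pd] u_measurable \<tau>_measurable
  have "(\<lambda>\<omega>. x k \<omega> + - (matrix_inv (G k \<omega>) *v g (x k \<omega>))) \<in> borel_measurable (F (Suc k))"
    by measurable
  then have [measurable]: "x (Suc k) \<in> borel_measurable (F (Suc k))"
    by (rule measurable_cong[THEN iffD2, rotated]) (simp add: space_F qn_run.x_Suc[OF run])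
  have "(\<lambda>\<omega>. Broyd (\<tau> k \<omega>)
      ((1 + M * local_norm f (x k \<omega>) (- (matrix_inv (G k \<omega>) *v g (x k \<omega>)))) *\<^sub>R G k \<omega>)
      (H (x (Suc k) \<omega>)) (u k \<omega>)) \<in> borel_measurable (F (Suc k))"
    by measurable
  then have "G (Suc k) \<in> borel_measurable (F (Suc k))"
    by (rule measurable_cong[THEN iffD2, rotated]) (simp add: space_F qn_run.G_Suc[OF run])
  then show ?case by simp
qed

lemmas x_adapted = conjunct1[OF adapted] and G_adapted = conjunct2[OF adapted]

lemma x_borel [measurable]: "x k \<in> borel_measurable P"
  and G_borel [measurable]: "G k \<in> borel_measurable P"
  by (rule measurable_from_subalg[OF subalg x_adapted] measurable_from_subalg[OF subalg G_adapted])+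

abbreviation "l k \<omega> \<equiv> local_grad_norm f (x k \<omega>)"
abbreviation "\<theta> k \<omega> \<equiv> merit (x k \<omega>) (G k \<omega>)"
abbreviation "R k \<omega> \<equiv> scaled_residual (x k \<omega>) (G k \<omega>)"

lemma F_pos_def: "\<omega> \<in> space (F k) \<Longrightarrow> pos_def (G k \<omega>)"
  by (simp add: space_F pos_def_G)

text \<open>The next point is known one stage earlier than the next matrix, so weights and Hessians
  at \<open>x (Suc k)\<close> are independent of \<open>u k\<close>.\<close>

lemma x_Suc_predictable: "x (Suc k) \<in> borel_measurable (F k)"
proof -
  note [measurable] = x_adapted[of k] borel_measurable_newton_step[OF x_adapted G_adapted F_pos_def, of k]
  have "(\<lambda>\<omega>. x k \<omega> + - (matrix_inv (G k \<omega>) *v g (x k \<omega>))) \<in> borel_measurable (F k)"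
    by measurable
  then show ?thesis
    by (rule measurable_cong[THEN iffD2, rotated]) (simp add: space_F qn_run.x_Suc[OF run])
qed

lemma R_adapted: "R k \<in> borel_measurable (F k)"
  by (rule borel_measurable_newton_step(3)[OF x_adapted G_adapted F_pos_def])

lemma merit_borel [measurable]: "\<theta> k \<in> borel_measurable P"
  by (rule borel_measurable_merit) measurable

lemma \<eta>_ge_1: "1 \<le> \<eta>" and d_eq: "d = real CARD('n)" and d_ge_2: "2 \<le> d"
proof -
  obtain \<omega> where "\<omega> \<in> space P" using not_empty by blast
  note o = run[OF this]
  show "1 \<le> \<eta>" "d = real CARD('n)" "2 \<le> d"
    by (rule qn_run.\<eta>[OF o] qn_run.d[OF o] qn_run.d_ge_2[OF o])+
qed

lemma merit_integrable: "integrable P (\<theta> k)"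
  using qn_run.merit_bounded[OF run] qn_run.merit_nonneg[OF run]
  by (intro integrable_const_bound[of _ "2 * d * \<eta>"]) auto

lemma l_le: "\<omega> \<in> space P \<Longrightarrow> l k \<omega> \<le> local_grad_norm f x0"
  using qn_run.l_le[OF run] qn_run.x_0[OF run] by metis

lemma isotropic_entry:
  fixes i j k
  defines "q v \<equiv> v $ i * v $ j / (v \<bullet> v)"
  shows "integrable P (\<lambda>\<omega>. q (u k \<omega>))" "(\<integral>\<omega>. q (u k \<omega>) \<partial>P) = (if i = j then 1 / d else 0)"
proof -
  let ?O = "\<lambda>u. (1 / (u \<bullet> u)) *\<^sub>R outer u (u :: real^'n)"
  have I: "(\<integral>u. ?O u \<partial>D) = (1 / d) *\<^sub>R mat 1"
    using directions by (simp add: isotropic_directions_def d_eq)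
  \<comment> \<open>The Bochner integral of a non-integrable function is 0 by default, so the
    nonzero value I/d forces integrability.\<close>
  have "((1 / d) *\<^sub>R mat 1 :: real^'n^'n) \<noteq> 0"
    using d_ge_2 by (simp add: vec_eq_iff mat_def)
  then have int: "integrable D ?O"
    unfolding I[symmetric] using not_integrable_integral_eq[of D ?O] by blast
  have bl: "bounded_linear (\<lambda>A :: real^'n^'n. A $ i $ j)"
    using bounded_linear_compose[OF bounded_linear_vec_nth bounded_linear_vec_nth] .
  have q: "q = (\<lambda>v. ?O v $ i $ j)" by (simp add: q_def outer_def fun_eq_iff)
  have qD: "integrable D q" unfolding q by (rule integrable_bounded_linear[OF bl int])
  have "(\<integral>v. q v \<partial>D) = ((1 / d) *\<^sub>R mat 1 :: real^'n^'n) $ i $ j"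
    unfolding q I[symmetric] by (rule integral_bounded_linear[OF bl int])
  then have qI: "(\<integral>v. q v \<partial>D) = (if i = j then 1 / d else 0)"
    by (simp add: mat_def)
  have qm: "q \<in> borel_measurable borel" unfolding q_def by measurable
  show "integrable P (\<lambda>\<omega>. q (u k \<omega>))"
    using qD unfolding distr_u[of k, symmetric] by (rule integrable_distr[OF u_borel])
  show "(\<integral>\<omega>. q (u k \<omega>) \<partial>P) = (if i = j then 1 / d else 0)"
    using qI integral_distr[OF u_borel qm, of k] unfolding distr_u by simp
qed

lemma u_nonzero: "AE \<omega> in P. u k \<omega> \<noteq> 0"
proof -
  have "AE v in distr P borel (u k). v \<noteq> 0"
    using directions unfolding distr_u isotropic_directions_def by simp
  then show ?thesis by (rule AE_distrD[OF u_borel])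
qed

text \<open>Averaging over \<open>u\<^sub>k\<close>, which is independent of the bounded matrix \<open>w R\<^sub>k\<close>, replaces
  \<open>u u\<^sup>T / u\<^sup>T u\<close> by \<open>I / d\<close>.\<close>

lemma expectation_direction:
  assumes w: "w \<in> borel_measurable (F k)" and wb: "\<And>\<omega>. \<omega> \<in> space P \<Longrightarrow> \<bar>w \<omega>\<bar> \<le> W"
  shows "integrable P (\<lambda>\<omega>. w \<omega> * ((u k \<omega> \<bullet> (R k \<omega> *v u k \<omega>)) / (u k \<omega> \<bullet> u k \<omega>)))"
    and "(\<integral>\<omega>. w \<omega> * ((u k \<omega> \<bullet> (R k \<omega> *v u k \<omega>)) / (u k \<omega> \<bullet> u k \<omega>)) \<partial>P)
      = (\<integral>\<omega>. w \<omega> * trace (R k \<omega>) \<partial>P) / d"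
    and "integrable P (\<lambda>\<omega>. w \<omega> * trace (R k \<omega>))"
proof -
  define q where "q i j v = v $ i * v $ j / (v \<bullet> v)" for i j and v :: "real^'n"
  define Z where "Z i j \<omega> = w \<omega> * R k \<omega> $ i $ j" for i j \<omega>
  have ZF: "Z i j \<in> borel_measurable (F k)" for i j
    unfolding Z_def using w R_adapted[of k] by measurable
  have Zint: "integrable P (Z i j)" for i j
  proof (rule integrable_const_bound)
    show "Z i j \<in> borel_measurable P" by (rule measurable_from_subalg[OF subalg ZF])
    have "\<bar>R k \<omega> $ i $ j\<bar> \<le> 2 * \<eta> * L" if "\<omega> \<in> space P" for \<omega>
      using psd_entry_bound[OF qn_run.psd_scaled_residual[OF run[OF that]]
        qn_run.scaled_residual_form[OF run[OF that]]] .
    then show "AE \<omega> in P. norm (Z i j \<omega>) \<le> W * (2 * \<eta> * L)"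
      using wb by (intro AE_I2) (auto simp: Z_def abs_mult intro!: mult_mono intro: order_trans[OF abs_ge_zero])
  qed
  \<comment> \<open>Working entry by entry needs only products of independent scalars, and no
    conditional expectation.\<close>
  have indep: "indep_var borel (Z i j) borel (\<lambda>\<omega>. q i j (u k \<omega>))" for i j
    by (rule indep_var_of_indep_set[OF indep_u space_F ZF _ u_borel]) (simp add: q_def)
  note qi = isotropic_entry(1)[folded q_def] and qe = isotropic_entry(2)[folded q_def]
  have int: "integrable P (\<lambda>\<omega>. Z i j \<omega> * q i j (u k \<omega>))" for i j
    by (rule indep_var_integrable[OF indep Zint qi])
  have ex: "(\<integral>\<omega>. Z i j \<omega> * q i j (u k \<omega>) \<partial>P) = (\<integral>\<omega>. Z i j \<omega> \<partial>P) * (if i = j then 1 / d else 0)" for i j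
    using indep_var_lebesgue_integral[OF indep Zint qi] unfolding qe .
  have form: "v \<bullet> (A *v v) = (\<Sum>i\<in>UNIV. \<Sum>j\<in>UNIV. A $ i $ j * (v $ i * v $ j))" for A :: "real^'n^'n" and v
    by (simp add: inner_vec_def matrix_vector_mult_def sum_distrib_left mult_ac)
  have eq: "w \<omega> * ((u k \<omega> \<bullet> (R k \<omega> *v u k \<omega>)) / (u k \<omega> \<bullet> u k \<omega>)) = (\<Sum>i\<in>UNIV. \<Sum>j\<in>UNIV. Z i j \<omega> * q i j (u k \<omega>))" for \<omega>
    unfolding form by (simp add: Z_def q_def sum_distrib_left sum_divide_distrib mult_ac)
  have tr: "w \<omega> * trace (R k \<omega>) = (\<Sum>i\<in>UNIV. Z i i \<omega>)" for \<omega>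
    by (simp add: trace_def Z_def sum_distrib_left)
  show "integrable P (\<lambda>\<omega>. w \<omega> * ((u k \<omega> \<bullet> (R k \<omega> *v u k \<omega>)) / (u k \<omega> \<bullet> u k \<omega>)))"
    unfolding eq using int by (intro Bochner_Integration.integrable_sum)
  show "integrable P (\<lambda>\<omega>. w \<omega> * trace (R k \<omega>))"
    unfolding tr using Zint by (intro Bochner_Integration.integrable_sum)
  have "(\<integral>\<omega>. w \<omega> * ((u k \<omega> \<bullet> (R k \<omega> *v u k \<omega>)) / (u k \<omega> \<bullet> u k \<omega>)) \<partial>P)
      = (\<Sum>i\<in>UNIV. \<Sum>j\<in>UNIV. (\<integral>\<omega>. Z i j \<omega> \<partial>P) * (if i = j then 1 / d else 0))"
    unfolding eq using int by (simp add: ex[symmetric] Bochner_Integration.integral_sum Bochner_Integration.integrable_sum)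
  also have "\<dots> = (\<Sum>i\<in>UNIV. (\<integral>\<omega>. Z i i \<omega> \<partial>P)) / d"
    by (simp add: if_distrib[of "(*) _"] sum_divide_distrib cong: if_cong)
  also have "(\<Sum>i\<in>UNIV. (\<integral>\<omega>. Z i i \<omega> \<partial>P)) = (\<integral>\<omega>. w \<omega> * trace (R k \<omega>) \<partial>P)"
    unfolding tr using Zint by (simp add: Bochner_Integration.integral_sum)
  finally show "(\<integral>\<omega>. w \<omega> * ((u k \<omega> \<bullet> (R k \<omega> *v u k \<omega>)) / (u k \<omega> \<bullet> u k \<omega>)) \<partial>P)
      = (\<integral>\<omega>. w \<omega> * trace (R k \<omega>) \<partial>P) / d" .
qed

definition "B = 4 * \<eta> * (2 * d + 1) * M"
definition "\<rho> = 1 - 1 / (d * (L / \<mu>))"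

lemma d\<kappa>_ge_2: "2 \<le> d * (L / \<mu>)"
proof -
  have "1 \<le> L / \<mu>" using \<mu> \<mu>_le_L by simp
  then have "2 * 1 \<le> d * (L / \<mu>)" using d_ge_2 by (intro mult_mono) auto
  then show ?thesis by simp
qed

lemma \<rho>_ge_half: "1 / 2 \<le> \<rho>" 
  using d\<kappa>_ge_2 le_imp_inverse_le[OF d\<kappa>_ge_2] by (simp add: \<rho>_def inverse_eq_divide)

lemma B_nonneg: "0 \<le> B"
  using \<eta>_ge_1 d_ge_2 M by (simp add: B_def)

lemma weight_le: "\<omega> \<in> space P \<Longrightarrow> exp (B * l k \<omega>) \<le> exp (B * local_grad_norm f x0)"
  using l_le B_nonneg by (simp add: mult_left_mono)

lemma weighted_merit_integrable: "integrable P (\<lambda>\<omega>. exp (B * l k \<omega>) * \<theta> k \<omega>)"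
proof (rule integrable_const_bound)
  have "exp (B * l k \<omega>) * \<theta> k \<omega> \<le> exp (B * local_grad_norm f x0) * (2 * d * \<eta>)"
    "0 \<le> \<theta> k \<omega>" if "\<omega> \<in> space P" for \<omega>
    by (intro mult_mono weight_le[OF that] qn_run.merit_bounded[OF run[OF that]]
        qn_run.merit_nonneg[OF run[OF that]] exp_ge_zero)+
  then show "AE \<omega> in P. norm (exp (B * l k \<omega>) * \<theta> k \<omega>) \<le> exp (B * local_grad_norm f x0) * (2 * d * \<eta>)"
    by (intro AE_I2) (simp add: abs_mult)
qed measurable

lemma weighted_merit_expectation_Suc:
  "(\<integral>\<omega>. exp (B * l (Suc k) \<omega>) * \<theta> (Suc k) \<omega> \<partial>P) \<le> \<rho> * (\<integral>\<omega>. exp (B * l k \<omega>) * \<theta> k \<omega> \<partial>P)"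
proof -
  define w where "w \<omega> = exp (B * l (Suc k) \<omega>)" for \<omega>
  define T where "T \<omega> = rel_trace (H (x (Suc k) \<omega>)) (R k \<omega>)" for \<omega>
  define Q where "Q \<omega> = (u k \<omega> \<bullet> (R k \<omega> *v u k \<omega>)) / (u k \<omega> \<bullet> u k \<omega>)" for \<omega>
  note [measurable] = x_Suc_predictable[of k]
  have wF: "w \<in> borel_measurable (F k)" unfolding w_def by measurable
  have wb: "\<omega> \<in> space P \<Longrightarrow> \<bar>w \<omega>\<bar> \<le> exp (B * local_grad_norm f x0)" for \<omega>
    unfolding w_def using weight_le by simp
  note dir = expectation_direction[OF wF wb, folded Q_def]
  \<comment> \<open>\<open>b\<close> dominates the new weighted merit almost surely; averaging over
    \<open>u k\<close> turns its \<open>Q\<close> term into the trace term of \<open>b'\<close>,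
    which is then bounded pathwise.\<close>
  define b where "b \<omega> = w \<omega> * (T \<omega> + 2 * d * M * l (Suc k) \<omega>) - w \<omega> * Q \<omega> / L" for \<omega>
  define b' where "b' \<omega> = w \<omega> * (T \<omega> + 2 * d * M * l (Suc k) \<omega>) - w \<omega> * trace (R k \<omega>) / (L * d)" for \<omega>
  have RP [measurable]: "R k \<in> borel_measurable P"
    by (rule measurable_from_subalg[OF subalg R_adapted])
  have T [measurable]: "T \<in> borel_measurable P"
    unfolding T_def by (rule borel_measurable_rel_trace) (measurable, simp add: pos_def_H)
  have T0: "0 \<le> T \<omega>" and Tb: "\<mu> * T \<omega> \<le> trace (R k \<omega>)" if "\<omega> \<in> space P" for \<omega>
    unfolding T_def
    using rel_trace_nonneg[OF pos_def_H qn_run.psd_scaled_residual[OF run[OF that]]]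
      rel_trace_le_trace[OF pos_def_H \<mu> H_lower qn_run.psd_scaled_residual[OF run[OF that]]] by auto
  have int1: "integrable P (\<lambda>\<omega>. w \<omega> * (T \<omega> + 2 * d * M * l (Suc k) \<omega>))"
  proof -
    have "integrable P (\<lambda>\<omega>. w \<omega> * T \<omega>)"
    proof (rule Bochner_Integration.integrable_bound)
      show "integrable P (\<lambda>\<omega>. (w \<omega> * trace (R k \<omega>)) / \<mu>)" using dir(3) by simp
      show "(\<lambda>\<omega>. w \<omega> * T \<omega>) \<in> borel_measurable P" unfolding w_def by measurable
      show "AE \<omega> in P. norm (w \<omega> * T \<omega>) \<le> norm (w \<omega> * trace (R k \<omega>) / \<mu>)"
      proof (rule AE_I2)
        fix \<omega> assume o: "\<omega> \<in> space P"
        have "T \<omega> \<le> trace (R k \<omega>) / \<mu>" using Tb[OF o] \<mu> by (simp add: pos_le_divide_eq mult.commute)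
        then have "\<bar>T \<omega>\<bar> \<le> \<bar>trace (R k \<omega>) / \<mu>\<bar>" using T0[OF o] by linarith
        then have "\<bar>w \<omega>\<bar> * \<bar>T \<omega>\<bar> \<le> \<bar>w \<omega>\<bar> * \<bar>trace (R k \<omega>) / \<mu>\<bar>" by (rule mult_left_mono) simp
        then show "norm (w \<omega> * T \<omega>) \<le> norm (w \<omega> * trace (R k \<omega>) / \<mu>)" by (simp add: abs_mult)
      qed
    qed
    moreover have "integrable P (\<lambda>\<omega>. w \<omega> * l (Suc k) \<omega>)"
    proof (rule integrable_const_bound)
      show "(\<lambda>\<omega>. w \<omega> * l (Suc k) \<omega>) \<in> borel_measurable P" unfolding w_def by measurable
      show "AE \<omega> in P. norm (w \<omega> * l (Suc k) \<omega>) \<le> exp (B * local_grad_norm f x0) * local_grad_norm f x0"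
        using wb l_le[of _ "Suc k"] local_grad_norm_nonneg
        by (intro AE_I2) (auto simp: abs_mult intro!: mult_mono)
    qed
    ultimately have "integrable P (\<lambda>\<omega>. w \<omega> * T \<omega> + 2 * d * M * (w \<omega> * l (Suc k) \<omega>))" by simp
    then show ?thesis by (simp add: algebra_simps)
  qed
  have "(\<integral>\<omega>. w \<omega> * \<theta> (Suc k) \<omega> \<partial>P) \<le> (\<integral>\<omega>. b \<omega> \<partial>P)"
  proof (rule integral_mono_AE)
    show "integrable P (\<lambda>\<omega>. w \<omega> * \<theta> (Suc k) \<omega>)" unfolding w_def by (rule weighted_merit_integrable)
    show "integrable P b" unfolding b_def using int1 dir(1) by simp
    have "w \<omega> * \<theta> (Suc k) \<omega> \<le> b \<omega>" if o: "\<omega> \<in> space P" and u: "u k \<omega> \<noteq> 0" for \<omega>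
    proof -
      have "\<theta> (Suc k) \<omega> \<le> T \<omega> + 2 * d * M * l (Suc k) \<omega> - Q \<omega> / L"
        using qn_run.excess_Suc[OF run[OF o] u] qn_run.merit_eq[OF run[OF o]]
        by (simp add: T_def Q_def mult.commute)
      then have "w \<omega> * \<theta> (Suc k) \<omega> \<le> w \<omega> * (T \<omega> + 2 * d * M * l (Suc k) \<omega> - Q \<omega> / L)"
        by (intro mult_left_mono) (simp_all add: w_def)
      then show ?thesis by (simp add: b_def right_diff_distrib)
    qed
    then show "AE \<omega> in P. w \<omega> * \<theta> (Suc k) \<omega> \<le> b \<omega>"
      using u_nonzero[of k] by (auto intro: AE_mp)
  qed
  also have "(\<integral>\<omega>. b \<omega> \<partial>P) = (\<integral>\<omega>. b' \<omega> \<partial>P)"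
    unfolding b_def b'_def using int1 dir by (simp add: mult.commute)
  also have "\<dots> \<le> (\<integral>\<omega>. \<rho> * (exp (B * l k \<omega>) * \<theta> k \<omega>) \<partial>P)"
  proof (rule integral_mono)
    show "integrable P b'" unfolding b'_def using int1 dir(3) by simp
    show "integrable P (\<lambda>\<omega>. \<rho> * (exp (B * l k \<omega>) * \<theta> k \<omega>))"
      using weighted_merit_integrable by simp
    fix \<omega> assume o: "\<omega> \<in> space P"
    \<comment> \<open>The left side is T / (d \<kappa>), the fraction that \<open>\<rho>\<close>
      removes.\<close>
    have "\<mu> * T \<omega> / (L * d) \<le> trace (R k \<omega>) / (L * d)"
      using Tb[OF o] L_pos d_ge_2 by (intro divide_right_mono) auto
    then have "T \<omega> + 2 * d * M * l (Suc k) \<omega> - trace (R k \<omega>) / (L * d) \<le> \<rho> * T \<omega> + 2 * d * M * l (Suc k) \<omega>"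
      by (simp add: \<rho>_def right_diff_distrib mult.commute)
    then have "w \<omega> * (T \<omega> + 2 * d * M * l (Suc k) \<omega> - trace (R k \<omega>) / (L * d))
        \<le> w \<omega> * (\<rho> * T \<omega> + 2 * d * M * l (Suc k) \<omega>)"
      by (intro mult_left_mono) (simp_all add: w_def)
    also have "\<dots> \<le> \<rho> * (exp (B * l k \<omega>) * \<theta> k \<omega>)"
      using qn_run.weighted_merit_step[OF run[OF o] \<rho>_ge_half] by (simp add: w_def T_def B_def)
    finally show "b' \<omega> \<le> \<rho> * (exp (B * l k \<omega>) * \<theta> k \<omega>)"
      by (simp add: b'_def right_diff_distrib)
  qed
  finally show ?thesis by (simp add: w_def)
qed

lemma expectation_merit: "expectation (\<theta> k) \<le> 2 * d * \<eta> * \<rho> ^ k"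
proof -
  have "expectation (\<theta> k) \<le> (\<integral>\<omega>. exp (B * l k \<omega>) * \<theta> k \<omega> \<partial>P)"
  proof (rule integral_mono[OF merit_integrable weighted_merit_integrable])
    fix \<omega> assume "\<omega> \<in> space P"
    then show "\<theta> k \<omega> \<le> exp (B * l k \<omega>) * \<theta> k \<omega>"
      using mult_right_mono[of 1 "exp (B * l k \<omega>)" "\<theta> k \<omega>"] qn_run.merit_nonneg[OF run]
        B_nonneg local_grad_norm_nonneg[of "x k \<omega>"] by simp
  qed
  also have "\<dots> \<le> \<rho> ^ k * (\<integral>\<omega>. exp (B * l 0 \<omega>) * \<theta> 0 \<omega> \<partial>P)"
  proof (induction k)
    case (Suc k)
    have "\<rho> * (\<integral>\<omega>. exp (B * l k \<omega>) * \<theta> k \<omega> \<partial>P) \<le> \<rho> * (\<rho> ^ k * (\<integral>\<omega>. exp (B * l 0 \<omega>) * \<theta> 0 \<omega> \<partial>P))"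
      using Suc \<rho>_ge_half by (intro mult_left_mono) auto
    then show ?case using weighted_merit_expectation_Suc[of k] by (simp add: mult.assoc)
  qed simp
  also have "\<dots> \<le> \<rho> ^ k * (2 * (d * \<eta>))"
  proof (rule mult_left_mono)
    have "(\<integral>\<omega>. exp (B * l 0 \<omega>) * \<theta> 0 \<omega> \<partial>P) \<le> (\<integral>\<omega>. 2 * (d * \<eta>) \<partial>P)"
    proof (rule integral_mono[OF weighted_merit_integrable])
      fix \<omega> assume o: "\<omega> \<in> space P"
      show "exp (B * l 0 \<omega>) * \<theta> 0 \<omega> \<le> 2 * (d * \<eta>)"
        using qn_run.exp_weight_0[OF run[OF o]] qn_run.merit_0[OF run[OF o]] qn_run.merit_nonneg[OF run[OF o]]
        unfolding B_def by (intro mult_mono) auto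
    qed simp
    then show "(\<integral>\<omega>. exp (B * l 0 \<omega>) * \<theta> 0 \<omega> \<partial>P) \<le> 2 * (d * \<eta>)" by (simp add: prob_space)
    show "0 \<le> \<rho> ^ k" using \<rho>_ge_half by simp
  qed
  finally show ?thesis by (simp add: mult_ac)
qed

end

section \<open>High-probability bounds\<close>

context qn_random
begin

lemma high_probability_bounds:
  fixes p :: real
  defines "C \<equiv> 4 * d ^ 3 * (L / \<mu>)\<^sup>2 * \<eta> / p" and "q \<equiv> 1 - 1 / (d * (L / \<mu>) + 1)"
  assumes p: "0 < p"
  shows "1 - p \<le> prob {\<omega> \<in> space P. \<forall>k. \<theta> k \<omega> \<le> C * q ^ k \<and>
    l k \<omega> \<le> C ^ k * q ^ (k * (k - 1) div 2) * local_grad_norm f x0}"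
    (is "_ \<le> prob ?E")
proof -
  define a where "a = d * (L / \<mu>)"
  have a: "2 \<le> a" using d\<kappa>_ge_2 by (simp add: a_def)
  have q: "q = a / (a + 1)" unfolding q_def a_def[symmetric] using a by (simp add: field_simps)
  have q0: "0 < q" using a by (simp add: q)
  \<comment> \<open>Twice this threshold is 4 d \<eta> a^2 / p with a = d \<kappa>, the origin of
    d^3 \<kappa>^2 in the theorem.\<close>
  have C: "C / 2 = 2 * d * \<eta> * a\<^sup>2 / p"
    by (simp add: C_def a_def power2_eq_square power3_eq_cube mult_ac)
  have dn: "0 < 2 * d * \<eta>" using d_ge_2 \<eta>_ge_1 by simp
  have C2: "0 < C / 2" unfolding C using a p by (intro divide_pos_pos mult_pos_pos[OF dn]) auto
  define t where "t = 1 - 1 / a\<^sup>2"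
  have \<rho>q: "\<rho> = t * q"
  proof -
    have "t = (a - 1) / a * ((a + 1) / a)" using a by (simp add: t_def field_simps power2_eq_square)
    moreover have "\<rho> = (a - 1) / a" unfolding \<rho>_def a_def[symmetric] using a by (simp add: field_simps)
    ultimately have "t * q = \<rho> * ((a + 1) / a * (a / (a + 1)))" by (simp only: q mult.assoc)
    also have "(a + 1) / a * (a / (a + 1)) = 1" using a by simp
    finally show ?thesis by simp
  qed
  have a2: "1 < a\<^sup>2" using a power_mono[of 2 a 2] by simp
  then have t: "0 \<le> t" "t < 1" using a by (auto simp: t_def divide_le_eq)
  \<comment> \<open>Half of the claimed bound serves as threshold, because
    \<open>l_Suc_merit_2\<close> multiplies the merit by 2.\<close>
  define bad where "bad k = {\<omega> \<in> space P. C / 2 * q ^ k \<le> \<theta> k \<omega>}" for k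
  have bad [measurable]: "bad k \<in> events" for k
    unfolding bad_def by measurable
  have prob_bad: "prob (bad k) \<le> p / a\<^sup>2 * t ^ k" for k
  proof -
    have "prob (bad k) \<le> expectation (\<theta> k) / (C / 2 * q ^ k)"
      unfolding bad_def
      using merit_integrable C2 q0 qn_run.merit_nonneg[OF run]
      by (intro integral_Markov_inequality_measure[where A = "{}"] mult_pos_pos) auto
    also have "\<dots> \<le> 2 * d * \<eta> * \<rho> ^ k / (C / 2 * q ^ k)"
      using C2 q0 expectation_merit by (intro divide_right_mono) auto
    also have "\<dots> = p / a\<^sup>2 * t ^ k"
    proof -
      have "K * (X * Y) / (K * A / p * Y) = p / A * X" if "K \<noteq> 0" "Y \<noteq> 0" "A \<noteq> 0" for K X Y A
        using that p by (simp add: field_simps)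
      then show ?thesis
        unfolding C \<rho>q power_mult_distrib using a dn q0 by auto
    qed
    finally show ?thesis .
  qed
  have geo: "(\<lambda>k. p / a\<^sup>2 * t ^ k) sums p"
  proof -
    have "(\<lambda>k. p / a\<^sup>2 * t ^ k) sums (p / a\<^sup>2 * (1 / (1 - t)))"
      using t by (intro sums_mult geometric_sums) auto
    moreover have "p / a\<^sup>2 * (1 / (1 - t)) = p" using a by (simp add: t_def)
    ultimately show ?thesis by simp
  qed
  have sm: "summable (\<lambda>k. prob (bad k))"
    using prob_bad by (intro summable_comparison_test'[OF sums_summable[OF geo], of 0]) auto
  have "prob (\<Union>k. bad k) \<le> (\<Sum>k. prob (bad k))"
    by (rule finite_measure_subadditive_countably[OF _ sm]) (use bad in auto)
  also have "\<dots> \<le> p"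
    using suminf_le[OF prob_bad sm sums_summable[OF geo]] sums_unique[OF geo] by simp
  finally have "1 - p \<le> prob (space P - (\<Union>k. bad k))"
    by (subst prob_compl) auto
  also have "\<dots> \<le> prob ?E"
  proof (rule finite_measure_mono)
    show "?E \<in> events" by measurable
    show "space P - (\<Union>k. bad k) \<subseteq> ?E"
    proof
      fix \<omega> assume "\<omega> \<in> space P - (\<Union>k. bad k)"
      then have o: "\<omega> \<in> space P" and small: "\<theta> k \<omega> \<le> C / 2 * q ^ k" for k
        by (auto simp: bad_def not_le intro: less_imp_le)
      have pos: "0 \<le> C * q ^ k" for k using C2 q0 by simp
      have 1: "\<theta> k \<omega> \<le> C * q ^ k" for k using small[of k] pos[of k] by simp
      have 2: "l k \<omega> \<le> C ^ k * q ^ (k * (k - 1) div 2) * local_grad_norm f x0" for k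
      proof (induction k)
        case 0
        show ?case by (simp add: qn_run.x_0[OF run[OF o]])
      next
        case (Suc k)
        have e: "Suc k * (Suc k - 1) div 2 = k + k * (k - 1) div 2"
        proof -
          have "Suc k * (Suc k - 1) = k * 2 + k * (k - 1)" by (cases k) auto
          then show ?thesis by simp
        qed
        have "l (Suc k) \<omega> \<le> 2 * \<theta> k \<omega> * l k \<omega>" by (rule qn_run.l_Suc_merit_2[OF run[OF o]])
        also have "\<dots> \<le> (C * q ^ k) * (C ^ k * q ^ (k * (k - 1) div 2) * local_grad_norm f x0)"
          using small[of k] by (intro mult_mono[OF _ Suc pos local_grad_norm_nonneg]) simp
        also have "\<dots> = C ^ Suc k * q ^ (Suc k * (Suc k - 1) div 2) * local_grad_norm f x0"
          unfolding e by (simp add: power_add mult_ac)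
        finally show ?case .
      qed
      show "\<omega> \<in> ?E" using o 1 2 by blast
    qed
  qed
  finally show ?thesis .
qed

end

theorem theorem11:
  fixes f :: "real^'n \<Rightarrow> real"
    and M \<mu> L \<eta> \<kappa> d :: real
    and x0 :: "real^'n"
    and P :: "'w measure"
    and F :: "nat \<Rightarrow> 'w measure"
    and D :: "(real^'n) measure"
    and \<tau> :: "nat \<Rightarrow> 'w \<Rightarrow> real"
    and u x :: "nat \<Rightarrow> 'w \<Rightarrow> real^'n"
    and G :: "nat \<Rightarrow> 'w \<Rightarrow> real^'n^'n"
  defines "d \<equiv> real CARD('n)"
    and "\<kappa> \<equiv> L / \<mu>"
  assumes dim: "CARD('n) \<ge> 2"
    and params: "M > 0" "\<mu> > 0" "L > 0" "\<eta> \<ge> 1"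
    and diff: "twice_differentiable f"
    and ssc: "strongly_self_concordant M f"
    and sc: "strongly_convex \<mu> f"
    and smooth: "L_smooth L f"
    and directions: "isotropic_directions D"
    and random: "random_choices P F D (G 0) \<tau> u"
    and run: "\<And>\<omega>. \<omega> \<in> space P \<Longrightarrow>
          quasi_newton_run f M x0 (\<lambda>k. \<tau> k \<omega>) (\<lambda>k. u k \<omega>) (\<lambda>k. x k \<omega>) (\<lambda>k. G k \<omega>)"
    and init: "\<And>\<omega>. \<omega> \<in> space P \<Longrightarrow>
          hessian f x0 \<preceq> G 0 \<omega> \<and> G 0 \<omega> \<preceq> \<eta> *\<^sub>R hessian f x0"
    and close: "M * local_grad_norm f x0 \<le> ln 2 / (4 * \<eta> * (2 * d + 1))"
  shows "\<exists>\<delta> :: nat \<Rightarrow> 'w \<Rightarrow> real.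
      (\<forall>k. \<delta> k \<in> borel_measurable P) \<and>
      (\<forall>k. \<forall>\<omega>\<in>space P. 0 \<le> \<delta> k \<omega> \<and>
          hessian f (x k \<omega>) \<preceq> G k \<omega> \<and>
          G k \<omega> \<preceq> (1 + \<delta> k \<omega>) *\<^sub>R hessian f (x k \<omega>)) \<and>
      (\<forall>k. integrable P (\<delta> k) \<and>
          prob_space.expectation P (\<delta> k) \<le> 2 * d * \<eta> * (1 - 1 / (d * \<kappa>)) ^ k) \<and>
      (\<forall>p::real. 0 < p \<and> p < 1 \<longrightarrow>
          \<P>(\<omega> in P. \<forall>k.
              \<delta> k \<omega> \<le> 4 * d ^ 3 * \<kappa>\<^sup>2 * \<eta> / p * (1 - 1 / (d * \<kappa> + 1)) ^ k \<and>
              local_grad_norm f (x k \<omega>)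
                \<le> (4 * d ^ 3 * \<kappa>\<^sup>2 * \<eta> / p) ^ k
                   * (1 - 1 / (d * \<kappa> + 1)) ^ (k * (k - 1) div 2)
                   * local_grad_norm f x0)
          \<ge> 1 - p)"
proof -
  interpret qn_objective f M \<mu> L
    using params diff ssc sc smooth by unfold_locales (auto simp: twice_differentiable_def)
  have qn_run: "qn_run f M \<mu> L \<eta> x0 (\<lambda>k. \<tau> k \<omega>) (\<lambda>k. u k \<omega>) (\<lambda>k. x k \<omega>) (\<lambda>k. G k \<omega>) d"
    if "\<omega> \<in> space P" for \<omega>
    using that params dim run init close random
    by unfold_locales (auto simp: d_def random_choices_def)
  interpret qn_random f M \<mu> L \<eta> x0 d P F D \<tau> u x G
    by (intro qn_random.intro qn_random_axioms.intro qn_objective_axioms directions random qn_run)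
  show ?thesis
  proof (intro exI[of _ "\<lambda>k \<omega>. merit (x k \<omega>) (G k \<omega>)"] conjI allI ballI impI)
    fix p :: real assume "0 < p \<and> p < 1"
    then show "1 - p \<le> \<P>(\<omega> in P. \<forall>k.
        merit (x k \<omega>) (G k \<omega>) \<le> 4 * d ^ 3 * \<kappa>\<^sup>2 * \<eta> / p * (1 - 1 / (d * \<kappa> + 1)) ^ k \<and>
        local_grad_norm f (x k \<omega>) \<le> (4 * d ^ 3 * \<kappa>\<^sup>2 * \<eta> / p) ^ k
          * (1 - 1 / (d * \<kappa> + 1)) ^ (k * (k - 1) div 2) * local_grad_norm f x0)"
      unfolding \<kappa>_def by (intro high_probability_bounds) simp
  next
    show "expectation (\<lambda>\<omega>. merit (x k \<omega>) (G k \<omega>)) \<le> 2 * d * \<eta> * (1 - 1 / (d * \<kappa>)) ^ k" for k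
      unfolding \<kappa>_def using expectation_merit by (simp only: \<rho>_def)
  qed (simp_all add: merit_borel merit_integrable qn_run.merit_nonneg[OF qn_run]
      qn_run.lower[OF qn_run] qn_run.G_le_merit[OF qn_run])
qed

end
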